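(* Let $(\Omega,\mu)$ be a measure space, $\Phi\in L^1(\mu)$, and let $(\tau_u)_{u\in\Omega}$ be a (measurable) family of automorphisms of $\mathbb{Z}^\infty$ such that $\tau_u$ maps $(\mathbb{Z}^\infty_+)^c$ into $(\mathbb{Z}^\infty_+)^c$ for $\mu$-a.e. $u\in\Omega$. Then the Hausdorff operator $\mathcal{H}_{\Phi,\tau}$ acts in $\mathcal{D}_\infty$ and $$\|\mathcal{H}_{\Phi,\tau}\|_{\mathcal{L}(\mathcal{D}_\infty)}\le\|\Phi\|_{L^1(\mu)}.$$
   Context: $\mathbb{Z}^\infty$ is the additive group of infinite sequences of integers with finite support; $\mathbb{Z}^\infty_+=\{\alpha\in\mathbb{Z}^\infty:\alpha_k\ge0\ \forall k\}$; $(\mathbb{Z}^\infty_+)^c=\mathbb{Z}^\infty\setminus\mathbb{Z}^\infty_+$. Let $\mathfrak p=(p_1,p_2,\dots)=(2,3,5,\dots)$ be the sequence of primes; for $\alpha\in\mathbb{Z}^\infty_+$ put $\mathfrak p^\alpha=p_1^{\alpha_1}p_2^{\alpha_2}\cdots$, so $\alpha\mapsto\mathfrak p^\alpha$ is a bijection of $\mathbb{Z}^\infty_+$ onto the positive integers. $\mathcal{D}_\infty$ is the Banach space of all sums $D(s)=\sum_{n=1}^\infty a(n)n^{-s}$ of ordinary Dirichlet series which converge and define a bounded holomorphic function on $\{\mathrm{Re}\,s>0\}$, with the supremum norm on $\{\mathrm{Re}\,s>0\}$. $D\in\mathcal{D}_\infty$ is identified with its coefficient function $a(\mathfrak p^{(\cdot)}):\mathbb{Z}^\infty\to\mathbb{C}$,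 $\alpha\mapsto a(\mathfrak p^\alpha)$ for $\alpha\in\mathbb{Z}^\infty_+$, extended by $0$ to $(\mathbb{Z}^\infty_+)^c$; the norm of the coefficient function is that of $D$. The Hausdorff operator acts on coefficient functions by $$(\mathcal{H}_{\Phi,\tau}a(\mathfrak p^{(\cdot)}))(\alpha)=\int_\Omega\Phi(u)\,a(\mathfrak p^{\tau_u(\alpha)})\,d\mu(u)$$ (with $a(\mathfrak p^{\tau_u(\alpha)})=0$ if $\tau_u(\alpha)\notin\mathbb{Z}^\infty_+$). It "acts in $\mathcal{D}_\infty$" if it maps coefficient functions of elements of $\mathcal{D}_\infty$ to coefficient functions of elements of $\mathcal{D}_\infty$. The map $u\mapsto\tau_u\in\mathrm{Aut}(\mathbb{Z}^\infty)$ is assumed measurable, where $\mathrm{Aut}(\mathbb{Z}^\infty)$ has its natural topology. $\mathcal{L}(\mathcal{D}_\infty)$ is the space of bounded linear operators on $\mathcal{D}_\infty$ with the operator norm. *)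

theory Defs
  imports
    "HOL-Analysis.Analysis"
    "HOL-Library.Poly_Mapping"
    "HOL-Library.Infinite_Set"
    "HOL-Computational_Algebra.Primes"
begin

section \<open>The group of finitely supported integer sequences\<close>

text \<open>Sequences are indexed from 0, so that position \<open>k\<close> belongs to the prime \<open>p\<^sub>k\<^sub>+\<^sub>1\<close>.\<close>

type_synonym zinf = "(nat, int) poly_mapping"

definition zinf_plus :: "zinf set" where
  "zinf_plus = {\<alpha>. \<forall>k. 0 \<le> Poly_Mapping.lookup \<alpha> k}"

definition prime_seq :: "nat \<Rightarrow> nat" where
  "prime_seq = enumerate {p. prime p}"

text \<open>Only used on \<^const>\<open>zinf_plus\<close>; elsewhere negative exponents are truncated to 0.\<close>

definition prime_pow :: "zinf \<Rightarrow> nat" where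
  "prime_pow \<alpha> = (\<Prod>k\<in>Poly_Mapping.keys \<alpha>. prime_seq k ^ nat (Poly_Mapping.lookup \<alpha> k))"

lemma bij_betw_prime_seq: "bij_betw prime_seq UNIV {p. prime p}"
  unfolding prime_seq_def by (rule bij_enumerate) (rule primes_infinite)

lemma prime_prime_seq [simp]: "prime (prime_seq k)"
  using bij_betw_prime_seq by (auto simp: bij_betw_def)

lemma prime_seq_pos [simp]: "0 < prime_seq k"
  using prime_prime_seq prime_gt_0_nat by blast

lemma prime_seq_nz: "0 \<noteq> prime_seq k ^ m"
  using prime_seq_pos[of k] by simp

lemma inj_prime_seq: "inj prime_seq"
  using bij_betw_prime_seq by (auto simp: bij_betw_def)

lemma prime_pow_pos: "0 < prime_pow \<alpha>"
  unfolding prime_pow_def by (rule prod_pos) simp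

lemma multiplicity_prime_pow:
  "multiplicity (prime_seq k) (prime_pow \<alpha>) = nat (Poly_Mapping.lookup \<alpha> k)"
proof -
  have "multiplicity (prime_seq k) (prime_pow \<alpha>) =
      (\<Sum>j\<in>Poly_Mapping.keys \<alpha>.
         multiplicity (prime_seq k) (prime_seq j ^ nat (Poly_Mapping.lookup \<alpha> j)))"
    unfolding prime_pow_def
    by (rule prime_elem_multiplicity_prod_distrib) (simp_all add: prime_imp_prime_elem image_iff prime_seq_nz)
  also have "\<dots> = (\<Sum>j\<in>Poly_Mapping.keys \<alpha>. if j = k then nat (Poly_Mapping.lookup \<alpha> j) else 0)"
  proof (rule sum.cong[OF refl])
    fix j
    show "multiplicity (prime_seq k) (prime_seq j ^ nat (Poly_Mapping.lookup \<alpha> j)) =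
        (if j = k then nat (Poly_Mapping.lookup \<alpha> j) else 0)"
    proof (cases "j = k")
      case True
      then show ?thesis by (simp add: multiplicity_same_power prime_gt_0_nat)
    next
      case False
      then have "prime_seq k \<noteq> prime_seq j" using inj_prime_seq by (auto dest: injD)
      then show ?thesis using False
        by (simp add: multiplicity_distinct_prime_power)
    qed
  qed
  also have "\<dots> = nat (Poly_Mapping.lookup \<alpha> k)"
    by (simp add: in_keys_iff)
  finally show ?thesis .
qed

lemma bij_betw_prime_pow: "bij_betw prime_pow zinf_plus {1..}"
proof (rule bij_betwI')
  fix \<alpha> \<beta> assume "\<alpha> \<in> zinf_plus" "\<beta> \<in> zinf_plus"
  then have nn: "0 \<le> Poly_Mapping.lookup \<alpha> k" "0 \<le> Poly_Mapping.lookup \<beta> k" for k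
    by (auto simp: zinf_plus_def)
  show "(prime_pow \<alpha> = prime_pow \<beta>) = (\<alpha> = \<beta>)"
  proof
    assume "prime_pow \<alpha> = prime_pow \<beta>"
    then have "nat (Poly_Mapping.lookup \<alpha> k) = nat (Poly_Mapping.lookup \<beta> k)" for k
      by (metis multiplicity_prime_pow)
    then have "Poly_Mapping.lookup \<alpha> k = Poly_Mapping.lookup \<beta> k" for k
      using nn by (metis nat_0_le)
    then show "\<alpha> = \<beta>" by (intro poly_mapping_eqI)
  qed simp
next
  fix \<alpha> show "prime_pow \<alpha> \<in> {1..}" using prime_pow_pos[of \<alpha>] by simp
next
  fix n :: nat assume "n \<in> {1..}"
  then have n: "n > 0" by simp
  define f where "f = (\<lambda>k. int (multiplicity (prime_seq k) n))"
  have "{k. f k \<noteq> 0} \<subseteq> prime_seq -` prime_factors n"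
    using n by (auto simp: f_def prime_factors_multiplicity)
  then have fin: "finite {k. f k \<noteq> 0}"
    by (rule finite_subset) (rule finite_vimageI[OF _ inj_prime_seq], simp)
  define \<alpha> where "\<alpha> = Abs_poly_mapping f"
  have l: "Poly_Mapping.lookup \<alpha> = f"
    using fin by (simp add: \<alpha>_def Abs_poly_mapping_inverse)
  have mult: "multiplicity p n = multiplicity p (prime_pow \<alpha>)" if "prime p" for p
  proof -
    have "p \<in> range prime_seq"
      using that by (simp add: bij_betw_imp_surj_on[OF bij_betw_prime_seq])
    then obtain k where "p = prime_seq k" by (rule rangeE)
    then show ?thesis by (simp add: multiplicity_prime_pow l f_def)
  qed
  have "n = prime_pow \<alpha>"
    by (rule multiplicity_eq_nat[OF n prime_pow_pos mult])
  moreover have "\<alpha> \<in> zinf_plus" by (simp add: zinf_plus_def l f_def)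
  ultimately show "\<exists>\<alpha>\<in>zinf_plus. n = prime_pow \<alpha>" by (rule bexI)
qed

section \<open>Automorphisms\<close>

definition zinf_aut :: "(zinf \<Rightarrow> zinf) set" where
  "zinf_aut = {\<phi>. bij \<phi> \<and> (\<forall>\<alpha> \<beta>. \<phi> (\<alpha> + \<beta>) = \<phi> \<alpha> + \<phi> \<beta>)}"

text \<open>
  The group is discrete, so the compact-open topology on its automorphism group is the topology
  of pointwise convergence. Inversion is continuous for it: if \<open>\<phi> \<alpha> = \<beta>\<close>, then
  \<open>inv \<psi> \<beta> = \<alpha>\<close> for all \<open>\<psi>\<close> in the open set \<open>{\<psi>. \<psi> \<alpha> = \<beta>}\<close>. Hence it is also the
  (a priori finer) Braconnier topology, for which both \<open>\<phi>\<close> and \<open>inv \<phi>\<close> have to converge.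
\<close>

definition zinf_aut_topology :: "(zinf \<Rightarrow> zinf) topology" where
  "zinf_aut_topology =
     subtopology (product_topology (\<lambda>_. discrete_topology UNIV) UNIV) zinf_aut"

definition zinf_aut_borel :: "(zinf \<Rightarrow> zinf) measure" where
  "zinf_aut_borel = sigma zinf_aut {U. openin zinf_aut_topology U}"

section \<open>Bounded Dirichlet series on the right half-plane\<close>

definition right_half_plane :: "complex set" where
  "right_half_plane = {s. 0 < Re s}"

text \<open>A series is given by \<open>a :: nat \<Rightarrow> complex\<close>; the value \<open>a 0\<close> is never used.\<close>

definition dirichlet_term :: "(nat \<Rightarrow> complex) \<Rightarrow> complex \<Rightarrow> nat \<Rightarrow> complex" where
  "dirichlet_term a s n = a (Suc n) * of_nat (Suc n) powr (- s)"

definition dirichlet_sum :: "(nat \<Rightarrow> complex) \<Rightarrow> complex \<Rightarrow> complex" where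
  "dirichlet_sum a s = suminf (dirichlet_term a s)"

definition in_D_infinity :: "(nat \<Rightarrow> complex) \<Rightarrow> bool" where
  "in_D_infinity a \<longleftrightarrow>
     (\<forall>s\<in>right_half_plane. summable (dirichlet_term a s)) \<and>
     dirichlet_sum a holomorphic_on right_half_plane \<and>
     bounded (dirichlet_sum a ` right_half_plane)"

definition D_infinity_norm :: "(nat \<Rightarrow> complex) \<Rightarrow> real" where
  "D_infinity_norm a = (SUP s\<in>right_half_plane. cmod (dirichlet_sum a s))"

section \<open>Coefficient functions\<close>

definition coeff_fun :: "(nat \<Rightarrow> complex) \<Rightarrow> zinf \<Rightarrow> complex" where
  "coeff_fun a \<alpha> = (if \<alpha> \<in> zinf_plus then a (prime_pow \<alpha>) else 0)"

text \<open>The inverse of \<^const>\<open>coeff_fun\<close>, up to the irrelevant value at 0.\<close>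

definition coeff_seq :: "(zinf \<Rightarrow> complex) \<Rightarrow> nat \<Rightarrow> complex" where
  "coeff_seq A n = A (the_inv_into zinf_plus prime_pow n)"

lemma coeff_seq_coeff_fun: "n \<ge> 1 \<Longrightarrow> coeff_seq (coeff_fun a) n = a n"
proof -
  assume "n \<ge> 1"
  then have "the_inv_into zinf_plus prime_pow n \<in> zinf_plus"
    and "prime_pow (the_inv_into zinf_plus prime_pow n) = n"
    using bij_betw_apply[OF bij_betw_the_inv_into[OF bij_betw_prime_pow], of n]
      f_the_inv_into_f_bij_betw[OF bij_betw_prime_pow, of n] by simp_all
  then show ?thesis by (simp add: coeff_seq_def coeff_fun_def)
qed

definition D_coeffs :: "(zinf \<Rightarrow> complex) set" where
  "D_coeffs = coeff_fun ` {a. in_D_infinity a}"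

definition D_coeffs_norm :: "(zinf \<Rightarrow> complex) \<Rightarrow> real" where
  "D_coeffs_norm A = D_infinity_norm (coeff_seq A)"

lemma D_coeffs_norm_coeff_fun: "D_coeffs_norm (coeff_fun a) = D_infinity_norm a"
proof -
  have "dirichlet_term (coeff_seq (coeff_fun a)) = dirichlet_term a"
    by (intro ext) (simp add: dirichlet_term_def coeff_seq_coeff_fun)
  then show ?thesis
    by (simp add: D_coeffs_norm_def D_infinity_norm_def dirichlet_sum_def)
qed

definition bounded_linear_on_D :: "((zinf \<Rightarrow> complex) \<Rightarrow> zinf \<Rightarrow> complex) \<Rightarrow> bool" where
  "bounded_linear_on_D T \<longleftrightarrow>
     T ` D_coeffs \<subseteq> D_coeffs \<and>
     (\<forall>A\<in>D_coeffs. \<forall>B\<in>D_coeffs. T (\<lambda>\<alpha>. A \<alpha> + B \<alpha>) = (\<lambda>\<alpha>. T A \<alpha> + T B \<alpha>)) \<and>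
     (\<forall>c. \<forall>A\<in>D_coeffs. T (\<lambda>\<alpha>. c * A \<alpha>) = (\<lambda>\<alpha>. c * T A \<alpha>)) \<and>
     (\<exists>C. \<forall>A\<in>D_coeffs. D_coeffs_norm (T A) \<le> C * D_coeffs_norm A)"

definition D_op_norm :: "((zinf \<Rightarrow> complex) \<Rightarrow> zinf \<Rightarrow> complex) \<Rightarrow> real" where
  "D_op_norm T = (SUP A\<in>{A\<in>D_coeffs. D_coeffs_norm A \<le> 1}. D_coeffs_norm (T A))"

section \<open>Hausdorff operators\<close>

definition hausdorff ::
  "'a measure \<Rightarrow> ('a \<Rightarrow> complex) \<Rightarrow> ('a \<Rightarrow> zinf \<Rightarrow> zinf) \<Rightarrow> (zinf \<Rightarrow> complex) \<Rightarrow> zinf \<Rightarrow> complex"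
  where "hausdorff M \<Phi> \<tau> A \<alpha> = (LINT u|M. \<Phi> u * A (\<tau> u \<alpha>))"

text \<open>
  The Bochner integral is total, with value 0 for functions that are not integrable; the existence
  of the integrals is therefore part of the definition.
\<close>

definition hausdorff_acts_in_D ::
  "'a measure \<Rightarrow> ('a \<Rightarrow> complex) \<Rightarrow> ('a \<Rightarrow> zinf \<Rightarrow> zinf) \<Rightarrow> bool"
  where "hausdorff_acts_in_D M \<Phi> \<tau> \<longleftrightarrow>
     (\<forall>A\<in>D_coeffs. (\<forall>\<alpha>. integrable M (\<lambda>u. \<Phi> u * A (\<tau> u \<alpha>))) \<and>
        hausdorff M \<Phi> \<tau> A \<in> D_coeffs)"

end

theory Submission
  imports Defs "HOL-Complex_Analysis.Complex_Analysis" "HOL-Real_Asymp.Real_Asymp"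
begin

text \<open>
  Let \<open>A\<close> be a function on \<open>\<int>\<^sup>\<infinity>\<close> that vanishes outside \<open>\<int>\<^sup>\<infinity>\<^sub>+\<close>. The proof rests on the following
  description of the norm: \<open>A\<close> is the coefficient function of a series in \<open>\<D>\<^sub>\<infinity>\<close> of norm at most
  \<open>C\<close> if and only if the Laurent matrix \<open>(A (\<alpha> - \<beta>))\<close>, with rows and columns indexed by
  \<open>\<int>\<^sup>\<infinity>\<close>, has norm at most \<open>C\<close> on \<open>\<ell>\<^sup>2\<close> (\<open>laurent_bounded\<close>). The matrix condition mentions
  the group only: an automorphism permutes rows and columns (\<open>laurent_bounded_compose_hom\<close>), and
  integration against \<open>\<Phi>\<close> costs a factor \<open>\<parallel>\<Phi>\<parallel>\<^sub>1\<close> (\<open>laurent_bounded_hausdorff\<close>). The hypothesis on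
  \<open>\<tau>\<close> keeps the support inside \<open>\<int>\<^sup>\<infinity>\<^sub>+\<close>.

  From series to matrices (\<open>in_D_infinity_imp_laurent_bounded\<close>): write \<open>\<lambda> \<alpha> = \<Sum>\<^sub>k \<alpha>\<^sub>k log p\<^sub>k\<close>. The mean
  value of \<open>D(s) exp (\<lambda>(\<gamma>) s)\<close> over any vertical line in \<open>Re s > 0\<close> is \<open>A \<gamma>\<close>. This is clear on
  \<open>Re s = 3\<close>, where the series converges absolutely, and the mean does not depend on the line because
  a primitive of this function has bounded increments along horizontal segments. Hence the form of
  the matrix at \<open>x, y\<close> is the mean of \<open>D X Y\<close> with almost periodic polynomials \<open>X, Y\<close>, and
  \<open>2 \<bar>X Y\<bar> \<le> \<bar>X\<bar>\<^sup>2 + \<bar>Y\<bar>\<^sup>2\<close> together with orthogonality gives the bound as the line moves to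
  \<open>Re s = 0\<close>.

  From matrices to series (\<open>laurent_bounded_imp_in_D_infinity\<close>): if \<open>m (\<alpha> - \<beta>)\<close> is an inner product of
  vectors of norm at most 1, then \<open>A\<close> may be replaced by \<open>m A\<close> without increasing the norm of the
  matrix (\<open>laurent_bounded_schur\<close>). Translates of tents and of \<open>exp (- \<sigma> \<bar>\<cdot>\<bar>)\<close>, composed with \<open>\<lambda>\<close>,
  have this form. The cutoff of \<open>A\<close> to integers \<open>n \<le> X\<close> is a sum of \<open>O(log X)\<close> tents at dyadic
  distances from the edge \<open>log X\<close>, so it costs only a factor \<open>O(log X)\<close>, while on the range
  \<open>n > X\<close> the factor \<open>n\<^sup>-\<^sup>\<sigma>\<close> gains \<open>X\<^sup>-\<^sup>\<sigma>\<close>. A finitely supported function of norm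
  \<open>K\<close> gives a Dirichlet polynomial bounded by \<open>K\<close> (\<open>laurent_bounded_sum_character_le\<close>). So the
  partial sums converge uniformly on \<open>Re s \<ge> r\<close> for every \<open>r > 0\<close>, and the limit is bounded by
  \<open>C\<close>.
\<close>

section \<open>Functions on an abelian group with bounded Laurent matrix\<close>

text \<open>
  Replacing \<open>x, y\<close> by \<open>c x, y / c\<close> and optimising over \<open>c > 0\<close> turns the right-hand side into
  \<open>C \<parallel>x\<parallel> \<parallel>y\<parallel>\<close>, so this says that the matrix \<open>(A (\<alpha> - \<beta>))\<close> has norm at most \<open>C\<close> on \<open>\<ell>\<^sup>2\<close>. The
  arithmetic mean of the squared norms is used because it is additive: it can be summed,
  integrated and averaged term by term.
\<close>

definition laurent_bounded :: "real \<Rightarrow> ('g::ab_group_add \<Rightarrow> complex) \<Rightarrow> bool" where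
  "laurent_bounded C A \<longleftrightarrow>
     (\<forall>S x y. finite S \<longrightarrow>
        cmod (\<Sum>\<alpha>\<in>S. \<Sum>\<beta>\<in>S. A (\<alpha> - \<beta>) * x \<alpha> * y \<beta>)
          \<le> C * (\<Sum>\<alpha>\<in>S. ((cmod (x \<alpha>))\<^sup>2 + (cmod (y \<alpha>))\<^sup>2) / 2))"

lemma laurent_boundedI:
  assumes "\<And>S x y. finite S \<Longrightarrow>
        cmod (\<Sum>\<alpha>\<in>S. \<Sum>\<beta>\<in>S. A (\<alpha> - \<beta>) * x \<alpha> * y \<beta>)
          \<le> C * (\<Sum>\<alpha>\<in>S. ((cmod (x \<alpha>))\<^sup>2 + (cmod (y \<alpha>))\<^sup>2) / 2)"
  shows "laurent_bounded C A"
  using assms by (simp add: laurent_bounded_def)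

lemma laurent_boundedD:
  assumes "laurent_bounded C A" "finite S"
  shows "cmod (\<Sum>\<alpha>\<in>S. \<Sum>\<beta>\<in>S. A (\<alpha> - \<beta>) * x \<alpha> * y \<beta>)
          \<le> C * (\<Sum>\<alpha>\<in>S. ((cmod (x \<alpha>))\<^sup>2 + (cmod (y \<alpha>))\<^sup>2) / 2)"
  using assms by (simp add: laurent_bounded_def)

lemma laurent_bounded_add:
  fixes A B :: "'g::ab_group_add \<Rightarrow> complex"
  assumes "laurent_bounded C A" "laurent_bounded D B"
  shows "laurent_bounded (C + D) (\<lambda>\<gamma>. A \<gamma> + B \<gamma>)"
proof (rule laurent_boundedI)
  fix S :: "'g set" and x y :: "'g \<Rightarrow> complex"
  assume S: "finite S"
  let ?N = "\<Sum>\<alpha>\<in>S. ((cmod (x \<alpha>))\<^sup>2 + (cmod (y \<alpha>))\<^sup>2) / 2"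
  have "(\<Sum>\<alpha>\<in>S. \<Sum>\<beta>\<in>S. (A (\<alpha> - \<beta>) + B (\<alpha> - \<beta>)) * x \<alpha> * y \<beta>)
      = (\<Sum>\<alpha>\<in>S. \<Sum>\<beta>\<in>S. A (\<alpha> - \<beta>) * x \<alpha> * y \<beta>) + (\<Sum>\<alpha>\<in>S. \<Sum>\<beta>\<in>S. B (\<alpha> - \<beta>) * x \<alpha> * y \<beta>)"
    by (simp add: distrib_right sum.distrib)
  also have "cmod \<dots> \<le> C * ?N + D * ?N"
    by (intro norm_triangle_mono laurent_boundedD assms S)
  finally show "cmod (\<Sum>\<alpha>\<in>S. \<Sum>\<beta>\<in>S. (A (\<alpha> - \<beta>) + B (\<alpha> - \<beta>)) * x \<alpha> * y \<beta>) \<le> (C + D) * ?N"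
    by (simp add: distrib_right)
qed

lemma laurent_bounded_cmult:
  fixes A :: "'g::ab_group_add \<Rightarrow> complex"
  assumes "laurent_bounded C A"
  shows "laurent_bounded (cmod c * C) (\<lambda>\<gamma>. c * A \<gamma>)"
proof (rule laurent_boundedI)
  fix S :: "'g set" and x y :: "'g \<Rightarrow> complex"
  assume S: "finite S"
  let ?N = "\<Sum>\<alpha>\<in>S. ((cmod (x \<alpha>))\<^sup>2 + (cmod (y \<alpha>))\<^sup>2) / 2"
  have "(\<Sum>\<alpha>\<in>S. \<Sum>\<beta>\<in>S. (c * A (\<alpha> - \<beta>)) * x \<alpha> * y \<beta>)
      = c * (\<Sum>\<alpha>\<in>S. \<Sum>\<beta>\<in>S. A (\<alpha> - \<beta>) * x \<alpha> * y \<beta>)"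
    by (simp add: sum_distrib_left mult.assoc)
  also have "cmod \<dots> \<le> cmod c * (C * ?N)"
    unfolding norm_mult by (intro mult_left_mono laurent_boundedD assms S) simp
  finally show "cmod (\<Sum>\<alpha>\<in>S. \<Sum>\<beta>\<in>S. (c * A (\<alpha> - \<beta>)) * x \<alpha> * y \<beta>) \<le> (cmod c * C) * ?N"
    by (simp add: mult.assoc)
qed

lemma laurent_bounded_diff:
  assumes "laurent_bounded C A" "laurent_bounded D B"
  shows "laurent_bounded (C + D) (\<lambda>\<gamma>. A \<gamma> - B \<gamma>)"
  using laurent_bounded_add[OF assms(1) laurent_bounded_cmult[OF assms(2), of "-1"]] by simp

lemma laurent_bounded_norm_le:
  fixes A :: "'g::ab_group_add \<Rightarrow> complex"
  assumes "laurent_bounded C A"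
  shows "cmod (A \<gamma>) \<le> C"
proof -
  let ?x = "\<lambda>\<alpha>. if \<alpha> = \<gamma> then 1 else 0 :: complex" and ?y = "\<lambda>\<beta>. if \<beta> = 0 then 1 else 0 :: complex"
  have "(\<Sum>\<alpha>\<in>{\<gamma>, 0}. \<Sum>\<beta>\<in>{\<gamma>, 0}. A (\<alpha> - \<beta>) * ?x \<alpha> * ?y \<beta>) = A \<gamma>"
    by (cases "\<gamma> = 0") auto
  moreover have "(\<Sum>\<alpha>\<in>{\<gamma>, 0}. ((cmod (?x \<alpha>))\<^sup>2 + (cmod (?y \<alpha>))\<^sup>2) / 2) = 1"
    by (cases "\<gamma> = 0") auto
  ultimately show ?thesis
    using laurent_boundedD[OF assms, of "{\<gamma>, 0}" ?x ?y] by simp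
qed

lemma laurent_bounded_nonneg: "laurent_bounded C A \<Longrightarrow> 0 \<le> C"
  using laurent_bounded_norm_le[of C A 0] norm_ge_zero[of "A 0"] by linarith

lemma laurent_bounded_mono:
  fixes A :: "'a::ab_group_add \<Rightarrow> complex"
  assumes "laurent_bounded C A" "C \<le> D"
  shows "laurent_bounded D A"
proof (rule laurent_boundedI)
  fix S :: "'a set" and x y :: "'a \<Rightarrow> complex"
  assume "finite S"
  then have "cmod (\<Sum>\<alpha>\<in>S. \<Sum>\<beta>\<in>S. A (\<alpha> - \<beta>) * x \<alpha> * y \<beta>)
      \<le> C * (\<Sum>\<alpha>\<in>S. ((cmod (x \<alpha>))\<^sup>2 + (cmod (y \<alpha>))\<^sup>2) / 2)"
    by (rule laurent_boundedD[OF assms(1)])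
  also have "\<dots> \<le> D * (\<Sum>\<alpha>\<in>S. ((cmod (x \<alpha>))\<^sup>2 + (cmod (y \<alpha>))\<^sup>2) / 2)"
    using assms(2) by (intro mult_right_mono sum_nonneg) simp_all
  finally show "cmod (\<Sum>\<alpha>\<in>S. \<Sum>\<beta>\<in>S. A (\<alpha> - \<beta>) * x \<alpha> * y \<beta>)
      \<le> D * (\<Sum>\<alpha>\<in>S. ((cmod (x \<alpha>))\<^sup>2 + (cmod (y \<alpha>))\<^sup>2) / 2)" .
qed

text \<open>
  The form of the composed function on \<open>S\<close> is the form of \<open>A\<close> on \<open>\<tau> ` S\<close>, with the vectors
  relabelled.
\<close>

lemma laurent_bounded_compose_hom:
  fixes A :: "'h::ab_group_add \<Rightarrow> complex" and \<tau> :: "'g::ab_group_add \<Rightarrow> 'h"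
  assumes A: "laurent_bounded C A" and inj: "inj \<tau>"
    and hom: "\<And>\<alpha> \<beta>. \<tau> (\<alpha> - \<beta>) = \<tau> \<alpha> - \<tau> \<beta>"
  shows "laurent_bounded C (\<lambda>\<gamma>. A (\<tau> \<gamma>))"
proof (rule laurent_boundedI)
  fix S :: "'g set" and x y :: "'g \<Rightarrow> complex"
  assume S: "finite S"
  have inj': "inj_on \<tau> S" using inj by (rule inj_on_subset) simp
  have inv: "inv \<tau> (\<tau> \<alpha>) = \<alpha>" for \<alpha> using inj by simp
  show "cmod (\<Sum>\<alpha>\<in>S. \<Sum>\<beta>\<in>S. A (\<tau> (\<alpha> - \<beta>)) * x \<alpha> * y \<beta>)
          \<le> C * (\<Sum>\<alpha>\<in>S. ((cmod (x \<alpha>))\<^sup>2 + (cmod (y \<alpha>))\<^sup>2) / 2)"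
    using laurent_boundedD[OF A, of "\<tau> ` S" "\<lambda>\<alpha>. x (inv \<tau> \<alpha>)" "\<lambda>\<alpha>. y (inv \<tau> \<alpha>)"] S
    by (simp add: sum.reindex[OF inj'] inv hom)
qed

section \<open>Schur multipliers\<close>

text \<open>
  If \<open>m (\<alpha> - \<beta>)\<close> is the inner product of \<open>v \<alpha>\<close> and \<open>u \<beta>\<close> in \<open>L\<^sup>2(\<real>)\<close>, then the form of \<open>m A\<close> at
  \<open>x, y\<close> is the integral over \<open>w\<close> of the form of \<open>A\<close> at \<open>x \<alpha> * v \<alpha> w\<close>, \<open>y \<beta> * u \<beta> w\<close>, and the
  squared norms of these vectors integrate to at most those of \<open>x\<close> and \<open>y\<close>.
\<close>

lemma laurent_bounded_schur:
  fixes A :: "'g::ab_group_add \<Rightarrow> complex" and v u :: "'g \<Rightarrow> real \<Rightarrow> real"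
  assumes A: "laurent_bounded C A"
    and m: "\<And>\<alpha> \<beta>. has_bochner_integral lborel (\<lambda>w. v \<alpha> w * u \<beta> w) (m (\<alpha> - \<beta>))"
    and v: "\<And>\<alpha>. integrable lborel (\<lambda>w. (v \<alpha> w)\<^sup>2)" "\<And>\<alpha>. (LINT w|lborel. (v \<alpha> w)\<^sup>2) \<le> 1"
    and u: "\<And>\<alpha>. integrable lborel (\<lambda>w. (u \<alpha> w)\<^sup>2)" "\<And>\<alpha>. (LINT w|lborel. (u \<alpha> w)\<^sup>2) \<le> 1"
  shows "laurent_bounded C (\<lambda>\<gamma>. of_real (m \<gamma>) * A \<gamma>)"
proof (rule laurent_boundedI)
  fix S :: "'g set" and x y :: "'g \<Rightarrow> complex"
  assume S: "finite S"
  let ?F = "\<lambda>w. \<Sum>\<alpha>\<in>S. \<Sum>\<beta>\<in>S. A (\<alpha> - \<beta>) * (x \<alpha> * of_real (v \<alpha> w)) * (y \<beta> * of_real (u \<beta> w))"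
  let ?G = "\<lambda>w. C * (\<Sum>\<alpha>\<in>S. ((cmod (x \<alpha>))\<^sup>2 * (v \<alpha> w)\<^sup>2 + (cmod (y \<alpha>))\<^sup>2 * (u \<alpha> w)\<^sup>2) / 2)"
  have C: "0 \<le> C" by (rule laurent_bounded_nonneg[OF A])
  have F: "has_bochner_integral lborel ?F (\<Sum>\<alpha>\<in>S. \<Sum>\<beta>\<in>S. of_real (m (\<alpha> - \<beta>)) * A (\<alpha> - \<beta>) * x \<alpha> * y \<beta>)"
  proof (intro has_bochner_integral_sum)
    fix \<alpha> \<beta>
    have "has_bochner_integral lborel (\<lambda>w. complex_of_real (v \<alpha> w * u \<beta> w) * (A (\<alpha> - \<beta>) * x \<alpha> * y \<beta>))
        (of_real (m (\<alpha> - \<beta>)) * (A (\<alpha> - \<beta>) * x \<alpha> * y \<beta>))"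
      by (intro has_bochner_integral_mult_left has_bochner_integral_of_real m)
    then show "has_bochner_integral lborel (\<lambda>w. A (\<alpha> - \<beta>) * (x \<alpha> * of_real (v \<alpha> w)) * (y \<beta> * of_real (u \<beta> w)))
        (of_real (m (\<alpha> - \<beta>)) * A (\<alpha> - \<beta>) * x \<alpha> * y \<beta>)"
      by (simp add: mult_ac)
  qed
  have intG: "integrable lborel ?G"
    by (intro integrable_mult_right Bochner_Integration.integrable_sum integrable_divide
        Bochner_Integration.integrable_add v u)
  have "cmod (LINT w|lborel. ?F w) \<le> (LINT w|lborel. ?G w)"
  proof (rule Bochner_Integration.integral_norm_bound_integral)
    show "integrable lborel ?F" using F by (simp add: has_bochner_integral_iff)
    show "cmod (?F w) \<le> ?G w" for w
      using laurent_boundedD[OF A S, of "\<lambda>\<alpha>. x \<alpha> * of_real (v \<alpha> w)" "\<lambda>\<alpha>. y \<alpha> * of_real (u \<alpha> w)"]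
      by (simp add: norm_mult power_mult_distrib)
  qed (rule intG)
  also have "(LINT w|lborel. ?G w) = C * (\<Sum>\<alpha>\<in>S. ((cmod (x \<alpha>))\<^sup>2 * (LINT w|lborel. (v \<alpha> w)\<^sup>2)
      + (cmod (y \<alpha>))\<^sup>2 * (LINT w|lborel. (u \<alpha> w)\<^sup>2)) / 2)"
    using v u by (simp add: Bochner_Integration.integral_sum Bochner_Integration.integral_add)
  also have "\<dots> \<le> C * (\<Sum>\<alpha>\<in>S. ((cmod (x \<alpha>))\<^sup>2 + (cmod (y \<alpha>))\<^sup>2) / 2)"
    using C v u by (intro mult_left_mono sum_mono divide_right_mono add_mono mult_left_le) auto
  finally show "cmod (\<Sum>\<alpha>\<in>S. \<Sum>\<beta>\<in>S. of_real (m (\<alpha> - \<beta>)) * A (\<alpha> - \<beta>) * x \<alpha> * y \<beta>)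
      \<le> C * (\<Sum>\<alpha>\<in>S. ((cmod (x \<alpha>))\<^sup>2 + (cmod (y \<alpha>))\<^sup>2) / 2)"
    using F by (simp add: has_bochner_integral_iff)
qed

text \<open>
  The overlap of two intervals of length \<open>W\<close> is \<open>W\<close> times a tent function of the difference of
  their left ends; moving the second interval by \<open>c\<close> moves the tent.
\<close>

lemma laurent_bounded_tent:
  fixes A :: "'g::ab_group_add \<Rightarrow> complex" and h :: "'g \<Rightarrow> real"
  assumes A: "laurent_bounded C A" and hom: "\<And>\<alpha> \<beta>. h (\<alpha> - \<beta>) = h \<alpha> - h \<beta>" and W: "0 < W"
  shows "laurent_bounded C (\<lambda>\<gamma>. of_real (max 0 (1 - \<bar>h \<gamma> - c\<bar> / W)) * A \<gamma>)"
proof (rule laurent_bounded_schur[OF A])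
  define I where "I = (\<lambda>a w. indicator {a..a + W} w / sqrt W)"
  have I: "has_bochner_integral lborel (\<lambda>w. I a w * I b w) (max 0 (1 - \<bar>a - b\<bar> / W))" for a b
  proof -
    have "has_bochner_integral lborel (\<lambda>w. indicator {max a b..min a b + W} w / W)
        (measure lborel {max a b..min a b + W} / W)"
      by (intro has_bochner_integral_divide_zero has_bochner_integral_real_indicator)
        (auto simp: emeasure_lborel_Icc_eq)
    moreover have "(\<lambda>w. indicator {max a b..min a b + W} w / W) = (\<lambda>w. I a w * I b w)"
      using W by (auto simp: I_def indicator_def fun_eq_iff min_def max_def)
    moreover have "measure lborel {max a b..min a b + W} / W = max 0 (1 - \<bar>a - b\<bar> / W)"
      using W by (auto simp: measure_def emeasure_lborel_Icc_eq field_simps max_def min_def)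
    ultimately show ?thesis by simp
  qed
  have *: "has_bochner_integral lborel (\<lambda>w. (I a w)\<^sup>2) 1" for a
    using I[of a a] by (simp add: power2_eq_square)
  show "has_bochner_integral lborel (\<lambda>w. I (h \<alpha>) w * I (h \<beta> + c) w)
      (max 0 (1 - \<bar>h (\<alpha> - \<beta>) - c\<bar> / W))" for \<alpha> \<beta>
    using I[of "h \<alpha>" "h \<beta> + c"] by (simp add: hom algebra_simps)
  show "integrable lborel (\<lambda>w. (I (h \<alpha>) w)\<^sup>2)" "integrable lborel (\<lambda>w. (I (h \<alpha> + c) w)\<^sup>2)"
    "(LINT w|lborel. (I (h \<alpha>) w)\<^sup>2) \<le> 1" "(LINT w|lborel. (I (h \<alpha> + c) w)\<^sup>2) \<le> 1" for \<alpha>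
    using *[of "h \<alpha>"] *[of "h \<alpha> + c"] by (auto simp: has_bochner_integral_iff)
qed

lemma has_bochner_integral_exp_tail:
  fixes k :: real
  assumes k: "0 < k"
  shows "has_bochner_integral lborel (\<lambda>w. indicator {a..} w * exp (- k * w)) (exp (- k * a) / k)"
proof (rule has_bochner_integral_nn_integral)
  have lim: "((\<lambda>w. - exp (- k * w) / k) \<longlongrightarrow> 0) at_top"
    using k by real_asymp
  have "(\<integral>\<^sup>+w. ennreal (exp (- k * w)) * indicator {a..} w \<partial>lborel) = 0 - (- exp (- k * a) / k)"
    by (rule nn_integral_FTC_atLeast[OF _ _ _ lim]) (use k in \<open>auto intro!: derivative_eq_intros\<close>)
  moreover have "ennreal (exp (- k * w)) * indicator {a..} w = ennreal (indicator {a..} w * exp (- k * w))" for w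
    by (simp add: indicator_def)
  ultimately show "(\<integral>\<^sup>+w. ennreal (indicator {a..} w * exp (- k * w)) \<partial>lborel) = ennreal (exp (- k * a) / k)"
    by simp
qed (use k in auto)

text \<open>
  The Gram vectors are one-sided exponentials starting at \<open>h \<alpha>\<close> and at \<open>h \<beta> + c\<close>.
\<close>

lemma laurent_bounded_exp:
  fixes A :: "'g::ab_group_add \<Rightarrow> complex" and h :: "'g \<Rightarrow> real"
  assumes A: "laurent_bounded C A" and hom: "\<And>\<alpha> \<beta>. h (\<alpha> - \<beta>) = h \<alpha> - h \<beta>" and k: "0 < k"
  shows "laurent_bounded C (\<lambda>\<gamma>. of_real (exp (- k * \<bar>h \<gamma> - c\<bar>)) * A \<gamma>)"
proof (rule laurent_bounded_schur[OF A])
  define I where "I = (\<lambda>a w. indicator {a..} w * (sqrt (2 * k) * exp (k * (a - w))))"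
  have I: "has_bochner_integral lborel (\<lambda>w. I a w * I b w) (exp (- k * \<bar>a - b\<bar>))" for a b
  proof -
    have "has_bochner_integral lborel
        (\<lambda>w. 2 * k * exp (k * (a + b)) * (indicator {max a b..} w * exp (- (2 * k) * w)))
        (2 * k * exp (k * (a + b)) * (exp (- (2 * k) * max a b) / (2 * k)))"
      using k by (intro has_bochner_integral_mult_right has_bochner_integral_exp_tail) simp
    moreover have "(\<lambda>w. 2 * k * exp (k * (a + b)) * (indicator {max a b..} w * exp (- (2 * k) * w))) = (\<lambda>w. I a w * I b w)"
      using k by (auto simp: I_def indicator_def fun_eq_iff max_def exp_add[symmetric] algebra_simps)
    moreover have "2 * k * exp (k * (a + b)) * (exp (- (2 * k) * max a b) / (2 * k)) = exp (- k * \<bar>a - b\<bar>)"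
      using k by (auto simp: max_def exp_add[symmetric] algebra_simps)
    ultimately show ?thesis by simp
  qed
  have *: "has_bochner_integral lborel (\<lambda>w. (I a w)\<^sup>2) 1" for a
    using I[of a a] by (simp add: power2_eq_square)
  show "has_bochner_integral lborel (\<lambda>w. I (h \<alpha>) w * I (h \<beta> + c) w)
      (exp (- k * \<bar>h (\<alpha> - \<beta>) - c\<bar>))" for \<alpha> \<beta>
    using I[of "h \<alpha>" "h \<beta> + c"] by (simp add: hom algebra_simps)
  show "integrable lborel (\<lambda>w. (I (h \<alpha>) w)\<^sup>2)" "integrable lborel (\<lambda>w. (I (h \<alpha> + c) w)\<^sup>2)"
    "(LINT w|lborel. (I (h \<alpha>) w)\<^sup>2) \<le> 1" "(LINT w|lborel. (I (h \<alpha> + c) w)\<^sup>2) \<le> 1" for \<alpha>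
    using *[of "h \<alpha>"] *[of "h \<alpha> + c"] by (auto simp: has_bochner_integral_iff)
qed

text \<open>
  The ramp is 1 up to \<open>E - E / 2 ^ j\<close> and falls linearly to 0 at \<open>E\<close>. A ramp of width \<open>w\<close> is the
  ramp of width \<open>2 w\<close> plus half a tent of half-width \<open>w\<close> centred at \<open>E - w\<close>, and on \<open>[0, \<infinity>)\<close> the
  ramp of width \<open>E\<close> is a tent. So a cutoff of width \<open>E / 2 ^ j\<close> costs a factor that grows only
  linearly in \<open>j\<close>; this is where the assumption on the sign of \<open>h\<close> on the support enters.
\<close>

lemma laurent_bounded_ramp:
  fixes A :: "'g::ab_group_add \<Rightarrow> complex" and h :: "'g \<Rightarrow> real"
  assumes A: "laurent_bounded C A" and hom: "\<And>\<alpha> \<beta>. h (\<alpha> - \<beta>) = h \<alpha> - h \<beta>" and E: "0 < E"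
    and supp: "\<And>\<gamma>. h \<gamma> < 0 \<Longrightarrow> A \<gamma> = 0"
  shows "laurent_bounded (C * (1 + real j / 2))
           (\<lambda>\<gamma>. of_real (min 1 (max 0 ((E - h \<gamma>) / (E / 2 ^ j)))) * A \<gamma>)"
proof (induction j)
  case 0
  have "of_real (max 0 (1 - \<bar>h \<gamma> - 0\<bar> / E)) * A \<gamma> = of_real (min 1 (max 0 ((E - h \<gamma>) / (E / 2 ^ 0)))) * A \<gamma>"
    for \<gamma>
    using E supp[of \<gamma>] by (cases "h \<gamma> < 0") (auto simp: field_simps max_def min_def)
  with laurent_bounded_tent[OF A hom E, of 0]
  have "laurent_bounded C (\<lambda>\<gamma>. of_real (min 1 (max 0 ((E - h \<gamma>) / (E / 2 ^ 0)))) * A \<gamma>)"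
    by (simp only:)
  then show ?case by simp
next
  case (Suc j)
  define w where "w = E / 2 ^ Suc j"
  have w: "0 < w" "E / 2 ^ j = 2 * w" using E by (auto simp: w_def)
  have ramp: "min 1 (max 0 ((E - t) / (2 * w))) + (1/2) * max 0 (1 - \<bar>t - (E - w)\<bar> / w)
      = min 1 (max 0 ((E - t) / w))" for t
    using w(1) by (auto simp: field_simps max_def min_def abs_if)
  have "laurent_bounded (C * (1 + real j / 2) + cmod (1/2) * C)
      (\<lambda>\<gamma>. of_real (min 1 (max 0 ((E - h \<gamma>) / (E / 2 ^ j)))) * A \<gamma>
         + 1/2 * (of_real (max 0 (1 - \<bar>h \<gamma> - (E - w)\<bar> / w)) * A \<gamma>))"
    by (intro laurent_bounded_add Suc.IH laurent_bounded_cmult laurent_bounded_tent A hom w)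
  moreover have "of_real (min 1 (max 0 ((E - h \<gamma>) / (E / 2 ^ j)))) * A \<gamma>
         + 1/2 * (of_real (max 0 (1 - \<bar>h \<gamma> - (E - w)\<bar> / w)) * A \<gamma>)
      = of_real (min 1 (max 0 ((E - h \<gamma>) / w))) * A \<gamma>" for \<gamma>
    unfolding ramp[of "h \<gamma>", symmetric] w(2) by (simp add: algebra_simps)
  moreover have "C * (1 + real j / 2) + cmod (1/2) * C = C * (1 + real (Suc j) / 2)"
    by (simp add: field_simps)
  ultimately show ?case by (simp only: w_def)
qed

section \<open>Logarithms of prime powers and boxes of exponents\<close>

text \<open>
  The homomorphism \<open>\<lambda>\<close> from \<open>\<int>\<^sup>\<infinity>\<close> to \<open>\<real>\<close>, the logarithm of the positive rational number with
  prime exponents \<open>\<alpha>\<close>.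
\<close>

definition log_val :: "zinf \<Rightarrow> real" where
  "log_val \<alpha> = (\<Sum>k\<in>Poly_Mapping.keys \<alpha>. real_of_int (Poly_Mapping.lookup \<alpha> k) * ln (real (prime_seq k)))"

lemma log_val_superset:
  assumes "finite K" "Poly_Mapping.keys \<alpha> \<subseteq> K"
  shows "log_val \<alpha> = (\<Sum>k\<in>K. real_of_int (Poly_Mapping.lookup \<alpha> k) * ln (real (prime_seq k)))"
  unfolding log_val_def
  by (rule sum.mono_neutral_left) (use assms in \<open>auto simp: in_keys_iff\<close>)

lemma log_val_diff: "log_val (\<alpha> - \<beta>) = log_val \<alpha> - log_val \<beta>"
proof -
  let ?K = "Poly_Mapping.keys \<alpha> \<union> Poly_Mapping.keys \<beta>"
  have "Poly_Mapping.keys (\<alpha> - \<beta>) \<subseteq> ?K" by (auto simp: in_keys_iff lookup_minus)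
  then show ?thesis
    by (subst (1 2 3) log_val_superset[of ?K])
      (auto simp: lookup_minus sum_subtractf left_diff_distrib)
qed

lemma log_val_add: "log_val (\<alpha> + \<beta>) = log_val \<alpha> + log_val \<beta>"
  using log_val_diff[of "\<alpha> + \<beta>" \<beta>] by simp

lemma log_val_eq_ln_prime_pow:
  assumes "\<alpha> \<in> zinf_plus"
  shows "log_val \<alpha> = ln (real (prime_pow \<alpha>))"
proof -
  have nn: "0 \<le> Poly_Mapping.lookup \<alpha> k" for k using assms by (simp add: zinf_plus_def)
  have "ln (real (prime_pow \<alpha>))
      = (\<Sum>k\<in>Poly_Mapping.keys \<alpha>. ln (real (prime_seq k) ^ nat (Poly_Mapping.lookup \<alpha> k)))"
    unfolding prime_pow_def of_nat_prod of_nat_power by (rule ln_prod) simp_all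
  also have "\<dots> = log_val \<alpha>"
    unfolding log_val_def using nn by (intro sum.cong refl) (simp add: ln_realpow)
  finally show ?thesis ..
qed

text \<open>
  Unique factorisation of rationals follows from that of integers after multiplication by a common
  denominator \<open>\<gamma>\<close>.
\<close>

lemma inj_log_val: "inj log_val"
proof (rule injI)
  fix \<alpha> \<beta> assume eq: "log_val \<alpha> = log_val \<beta>"
  (* Any sequence dominating the negative parts of both arguments would do. *)
  define \<gamma> where "\<gamma> = Poly_Mapping.map abs \<alpha> + Poly_Mapping.map abs \<beta>"
  have l: "Poly_Mapping.lookup \<gamma> k = \<bar>Poly_Mapping.lookup \<alpha> k\<bar> + \<bar>Poly_Mapping.lookup \<beta> k\<bar>" for k
    by (simp add: \<gamma>_def lookup_add Poly_Mapping.map.rep_eq when_def)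
  have pos: "\<alpha> + \<gamma> \<in> zinf_plus" "\<beta> + \<gamma> \<in> zinf_plus"
    by (auto simp: zinf_plus_def lookup_add l)
  have "ln (real (prime_pow (\<alpha> + \<gamma>))) = ln (real (prime_pow (\<beta> + \<gamma>)))"
    using eq by (simp add: log_val_eq_ln_prime_pow[OF pos(1), symmetric]
        log_val_eq_ln_prime_pow[OF pos(2), symmetric] log_val_add)
  then have "prime_pow (\<alpha> + \<gamma>) = prime_pow (\<beta> + \<gamma>)"
    using prime_pow_pos[of "\<alpha> + \<gamma>"] prime_pow_pos[of "\<beta> + \<gamma>"] by simp
  then have "\<alpha> + \<gamma> = \<beta> + \<gamma>"
    using bij_betw_imp_inj_on[OF bij_betw_prime_pow] pos by (auto dest: inj_onD)
  then show "\<alpha> = \<beta>" by simp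
qed

lemma log_val_eq_ln_iff:
  assumes "1 \<le> n"
  shows "log_val \<gamma> = ln (real n) \<longleftrightarrow> \<gamma> \<in> zinf_plus \<and> prime_pow \<gamma> = n"
proof
  assume eq: "log_val \<gamma> = ln (real n)"
  have "n \<in> prime_pow ` zinf_plus"
    using bij_betw_imp_surj_on[OF bij_betw_prime_pow] assms by simp
  then obtain \<gamma>' where \<gamma>': "\<gamma>' \<in> zinf_plus" "n = prime_pow \<gamma>'" by blast
  then have "log_val \<gamma> = log_val \<gamma>'" using eq by (simp add: log_val_eq_ln_prime_pow)
  then have "\<gamma> = \<gamma>'" by (rule injD[OF inj_log_val])
  with \<gamma>' show "\<gamma> \<in> zinf_plus \<and> prime_pow \<gamma> = n" by simp
qed (auto simp: log_val_eq_ln_prime_pow)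

definition zinf_box :: "nat \<Rightarrow> nat \<Rightarrow> zinf set" where
  "zinf_box N m = {\<alpha>. Poly_Mapping.keys \<alpha> \<subseteq> {..<N} \<and> (\<forall>k. \<bar>Poly_Mapping.lookup \<alpha> k\<bar> \<le> int m)}"

lemma bij_betw_zinf_box:
  "bij_betw (\<lambda>\<alpha>. restrict (Poly_Mapping.lookup \<alpha>) {..<N}) (zinf_box N m) (PiE {..<N} (\<lambda>_. {- int m..int m}))"
proof (rule bij_betwI')
  fix \<alpha> \<beta> assume ab: "\<alpha> \<in> zinf_box N m" "\<beta> \<in> zinf_box N m"
  show "(restrict (Poly_Mapping.lookup \<alpha>) {..<N} = restrict (Poly_Mapping.lookup \<beta>) {..<N}) = (\<alpha> = \<beta>)"
  proof
    assume eq: "restrict (Poly_Mapping.lookup \<alpha>) {..<N} = restrict (Poly_Mapping.lookup \<beta>) {..<N}"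
    show "\<alpha> = \<beta>"
    proof (rule poly_mapping_eqI)
      fix k
      show "Poly_Mapping.lookup \<alpha> k = Poly_Mapping.lookup \<beta> k"
      proof (cases "k < N")
        case True
        then show ?thesis using fun_cong[OF eq, of k] by simp
      next
        case False
        then have "k \<notin> Poly_Mapping.keys \<alpha>" "k \<notin> Poly_Mapping.keys \<beta>" using ab by (auto simp: zinf_box_def)
        then show ?thesis by (simp add: in_keys_iff)
      qed
    qed
  qed simp
next
  fix \<alpha> assume "\<alpha> \<in> zinf_box N m"
  then show "restrict (Poly_Mapping.lookup \<alpha>) {..<N} \<in> PiE {..<N} (\<lambda>_. {- int m..int m})"
    by (auto simp: zinf_box_def abs_le_iff minus_le_iff)
next
  fix f assume f: "f \<in> PiE {..<N} (\<lambda>_. {- int m..int m})"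
  define \<alpha> where "\<alpha> = Abs_poly_mapping (\<lambda>k. if k < N then f k else 0)"
  have l: "Poly_Mapping.lookup \<alpha> = (\<lambda>k. if k < N then f k else 0)"
    unfolding \<alpha>_def by (rule lookup_Abs_poly_mapping) (rule finite_subset[of _ "{..<N}"], auto)
  have "\<alpha> \<in> zinf_box N m"
    using f by (auto simp: zinf_box_def in_keys_iff l PiE_iff abs_le_iff minus_le_iff split: if_splits)
  moreover have "f = restrict (Poly_Mapping.lookup \<alpha>) {..<N}"
    using f by (auto simp: l fun_eq_iff PiE_iff extensional_def)
  ultimately show "\<exists>\<alpha>\<in>zinf_box N m. f = restrict (Poly_Mapping.lookup \<alpha>) {..<N}" by blast
qed

lemma finite_zinf_box: "finite (zinf_box N m)"
  and card_zinf_box: "card (zinf_box N m) = (2 * m + 1) ^ N"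
proof -
  show "finite (zinf_box N m)"
    using bij_betw_finite[OF bij_betw_zinf_box, of N m] by (simp add: finite_PiE)
  show "card (zinf_box N m) = (2 * m + 1) ^ N"
    using bij_betw_same_card[OF bij_betw_zinf_box, of N m] by (simp add: card_PiE nat_add_distrib nat_mult_distrib)
qed

lemma zinf_box_mono:
  assumes "m \<le> n" shows "zinf_box N m \<subseteq> zinf_box N n"
proof
  fix \<alpha> assume "\<alpha> \<in> zinf_box N m"
  moreover have "int m \<le> int n" using assms by simp
  ultimately show "\<alpha> \<in> zinf_box N n" unfolding zinf_box_def by (blast intro: order_trans)
qed

lemma zinf_box_add:
  assumes "\<alpha> \<in> zinf_box N m" "\<beta> \<in> zinf_box N d"
  shows "\<alpha> + \<beta> \<in> zinf_box N (m + d)"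
proof -
  have "\<bar>Poly_Mapping.lookup (\<alpha> + \<beta>) k\<bar> \<le> int (m + d)" for k
  proof -
    have "\<bar>Poly_Mapping.lookup \<alpha> k\<bar> \<le> int m" "\<bar>Poly_Mapping.lookup \<beta> k\<bar> \<le> int d"
      using assms by (simp_all add: zinf_box_def)
    then show ?thesis by (simp add: lookup_add)
  qed
  moreover have "Poly_Mapping.keys (\<alpha> + \<beta>) \<subseteq> {..<N}"
    using Poly_Mapping.keys_add[of \<alpha> \<beta>] assms unfolding zinf_box_def by blast
  ultimately show ?thesis by (simp add: zinf_box_def)
qed

lemma finite_subset_zinf_box:
  assumes "finite F"
  shows "\<exists>N d. F \<subseteq> zinf_box N d"
  using assms
proof (induction F rule: finite_induct)
  case (insert \<gamma> F)
  then obtain N d where F: "F \<subseteq> zinf_box N d" by blast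
  obtain N' where N': "Poly_Mapping.keys \<gamma> \<subseteq> {..<N'}"
    using finite_nat_iff_bounded[of "Poly_Mapping.keys \<gamma>"] by auto
  define d' where "d' = (\<Sum>k\<in>Poly_Mapping.keys \<gamma>. nat \<bar>Poly_Mapping.lookup \<gamma> k\<bar>)"
  have d': "\<bar>Poly_Mapping.lookup \<gamma> k\<bar> \<le> int d'" for k
  proof (cases "k \<in> Poly_Mapping.keys \<gamma>")
    case True
    then have "nat \<bar>Poly_Mapping.lookup \<gamma> k\<bar> \<le> d'"
      unfolding d'_def by (intro member_le_sum) simp_all
    then show ?thesis by (simp add: nat_le_iff)
  qed (simp add: in_keys_iff)
  have "\<gamma> \<in> zinf_box (max N N') d'"
    using N' d' by (auto simp: zinf_box_def)
  moreover have "F \<subseteq> zinf_box (max N N') d"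
    using F by (fastforce simp: zinf_box_def)
  ultimately have "insert \<gamma> F \<subseteq> zinf_box (max N N') (max d d')"
    using zinf_box_mono[of d "max d d'" "max N N'"] zinf_box_mono[of d' "max d d'" "max N N'"]
    by auto
  then show ?case by blast
qed simp

text \<open>
  Test the form with the character \<open>cis (h \<alpha>)\<close> on a box \<open>S\<close> and its conjugate on a smaller box \<open>Q\<close>
  such that \<open>Q + F \<subseteq> S\<close>. Each \<open>\<beta> \<in> Q\<close> contributes the full character sum, so the form equals the
  sum times \<open>card Q\<close>, and it is at most \<open>C (card S + card Q) / 2\<close>. Boxes of fixed dimension grow
  polynomially, so \<open>card S / card Q\<close> can be made close to 1.
\<close>

lemma laurent_bounded_sum_character_le:
  fixes A :: "zinf \<Rightarrow> complex" and h :: "zinf \<Rightarrow> real"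
  assumes A: "laurent_bounded C A" and F: "finite F" and supp: "\<And>\<gamma>. \<gamma> \<notin> F \<Longrightarrow> A \<gamma> = 0"
    and hom: "\<And>\<alpha> \<beta>. h (\<alpha> - \<beta>) = h \<alpha> - h \<beta>"
  shows "cmod (\<Sum>\<gamma>\<in>F. A \<gamma> * cis (h \<gamma>)) \<le> C"
proof -
  obtain N d where Fbox: "F \<subseteq> zinf_box N d" using finite_subset_zinf_box[OF F] by blast
  define Z where "Z = (\<Sum>\<gamma>\<in>F. A \<gamma> * cis (h \<gamma>))"
  have bound: "cmod Z \<le> C * ((((2 * real (m + d) + 1) / (2 * real m + 1)) ^ N + 1) / 2)" for m
  proof -
    let ?S = "zinf_box N (m + d)" and ?Q = "zinf_box N m"
    define y where "y = (\<lambda>\<beta>. if \<beta> \<in> ?Q then cis (- h \<beta>) else 0)"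
    have QS: "?Q \<subseteq> ?S" by (rule zinf_box_mono) simp
    have inner: "(\<Sum>\<alpha>\<in>?S. A (\<alpha> - \<beta>) * cis (h \<alpha>) * y \<beta>) = Z" if \<beta>: "\<beta> \<in> ?Q" for \<beta>
    proof -
      have "Z = (\<Sum>\<alpha>\<in>(\<lambda>\<gamma>. \<beta> + \<gamma>) ` F. A (\<alpha> - \<beta>) * cis (h (\<alpha> - \<beta>)))"
        unfolding Z_def by (subst sum.reindex) (auto simp: inj_on_def)
      also have "\<dots> = (\<Sum>\<alpha>\<in>?S. A (\<alpha> - \<beta>) * cis (h (\<alpha> - \<beta>)))"
      proof (rule sum.mono_neutral_left)
        show "(\<lambda>\<gamma>. \<beta> + \<gamma>) ` F \<subseteq> ?S" using zinf_box_add[OF \<beta>] Fbox by auto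
        show "\<forall>\<alpha>\<in>?S - (\<lambda>\<gamma>. \<beta> + \<gamma>) ` F. A (\<alpha> - \<beta>) * cis (h (\<alpha> - \<beta>)) = 0"
        proof
          fix \<alpha> assume \<alpha>: "\<alpha> \<in> ?S - (\<lambda>\<gamma>. \<beta> + \<gamma>) ` F"
          have "\<alpha> - \<beta> \<notin> F"
          proof
            assume "\<alpha> - \<beta> \<in> F"
            then have "\<beta> + (\<alpha> - \<beta>) \<in> (\<lambda>\<gamma>. \<beta> + \<gamma>) ` F" by (rule imageI)
            with \<alpha> show False by simp
          qed
          then show "A (\<alpha> - \<beta>) * cis (h (\<alpha> - \<beta>)) = 0" by (simp add: supp)
        qed
      qed (rule finite_zinf_box)
      also have "\<dots> = (\<Sum>\<alpha>\<in>?S. A (\<alpha> - \<beta>) * cis (h \<alpha>) * y \<beta>)"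
        using \<beta> by (simp add: y_def hom cis_mult mult.assoc)
      finally show ?thesis ..
    qed
    have "(\<Sum>\<alpha>\<in>?S. \<Sum>\<beta>\<in>?S. A (\<alpha> - \<beta>) * cis (h \<alpha>) * y \<beta>)
        = (\<Sum>\<beta>\<in>?S. \<Sum>\<alpha>\<in>?S. A (\<alpha> - \<beta>) * cis (h \<alpha>) * y \<beta>)"
      by (rule sum.swap)
    also have "\<dots> = (\<Sum>\<beta>\<in>?Q. \<Sum>\<alpha>\<in>?S. A (\<alpha> - \<beta>) * cis (h \<alpha>) * y \<beta>)"
      by (rule sum.mono_neutral_right) (auto simp: y_def QS finite_zinf_box)
    also have "\<dots> = of_nat (card ?Q) * Z" by (simp add: inner)
    finally have eq: "(\<Sum>\<alpha>\<in>?S. \<Sum>\<beta>\<in>?S. A (\<alpha> - \<beta>) * cis (h \<alpha>) * y \<beta>) = of_nat (card ?Q) * Z" .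
    have "(\<Sum>\<alpha>\<in>?S. (cmod (y \<alpha>))\<^sup>2) = (\<Sum>\<alpha>\<in>?Q. (cmod (y \<alpha>))\<^sup>2)"
      by (rule sum.mono_neutral_right) (auto simp: y_def QS finite_zinf_box)
    also have "\<dots> = real (card ?Q)" by (simp add: y_def)
    finally have ysum: "(\<Sum>\<alpha>\<in>?S. (cmod (y \<alpha>))\<^sup>2) = real (card ?Q)" .
    have "real (card ?Q) * cmod Z \<le> C * ((real (card ?S) + real (card ?Q)) / 2)"
      using laurent_boundedD[OF A finite_zinf_box[of N "m + d"], of "\<lambda>\<alpha>. cis (h \<alpha>)" y]
      unfolding eq by (simp add: norm_mult sum.distrib ysum flip: sum_divide_distrib)
    moreover have "0 < real (card ?Q)" by (simp add: card_zinf_box)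
    ultimately have "cmod Z \<le> C * ((real (card ?S) / real (card ?Q) + 1) / 2)"
      by (simp add: field_simps)
    then show ?thesis by (simp add: card_zinf_box power_divide add_ac)
  qed
  have "(\<lambda>m. (2 * real (m + d) + 1) / (2 * real m + 1)) \<longlonglongrightarrow> 1" by real_asymp
  then have "(\<lambda>m. C * ((((2 * real (m + d) + 1) / (2 * real m + 1)) ^ N + 1) / 2)) \<longlonglongrightarrow> C * ((1 ^ N + 1) / 2)"
    by (intro tendsto_intros) auto
  then have "cmod Z \<le> C * ((1 ^ N + 1) / 2)"
    by (rule Lim_bounded2) (use bound in auto)
  then show ?thesis by (simp add: Z_def)
qed

section \<open>From bounded Laurent matrices to bounded Dirichlet series\<close>

text \<open>
  An upper bound for the factor \<open>1 + j / 2\<close> of \<open>laurent_bounded_ramp\<close>, when \<open>j\<close> is about \<open>2 log\<^sub>2 (X + 1)\<close>;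
  then a ramp ending at \<open>ln (X + 1)\<close> has width at most \<open>1 / (X + 1)\<close>.
\<close>

definition trunc_loss :: "nat \<Rightarrow> real" where
  "trunc_loss X = 2 + log 2 (real X + 1)"

text \<open>
  No logarithm of an integer lies strictly between \<open>ln X\<close> and \<open>E = ln (X + 1)\<close>, so a ramp ending
  at \<open>E\<close> whose width is at most \<open>ln (X + 1) - ln X\<close> agrees with the sharp cutoff on the support of \<open>A\<close>.
\<close>

lemma laurent_bounded_truncate:
  fixes A :: "zinf \<Rightarrow> complex"
  assumes A: "laurent_bounded C A" and supp: "\<And>\<gamma>. \<gamma> \<notin> zinf_plus \<Longrightarrow> A \<gamma> = 0" and X: "1 \<le> X"
  shows "laurent_bounded (C * trunc_loss X) (\<lambda>\<gamma>. if prime_pow \<gamma> \<le> X then A \<gamma> else 0)"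
proof -
  define E where "E = ln (real X + 1)"
  (* The number of halvings is chosen so that 2 ^ j is at least (X + 1)^2, hence at least
     (X + 1) E, because E is at most X. *)
  define j where "j = nat \<lceil>2 * log 2 (real X + 1)\<rceil>"
  have E: "0 < E" using X by (simp add: E_def)
  have log0: "0 \<le> log 2 (real X + 1)" by simp
  have C: "0 \<le> C" by (rule laurent_bounded_nonneg[OF A])
  have j_le: "1 + real j / 2 \<le> trunc_loss X"
  proof -
    have "real j = real_of_int \<lceil>2 * log 2 (real X + 1)\<rceil>" unfolding j_def using log0 by simp
    then have "real j \<le> 2 * log 2 (real X + 1) + 1" by linarith
    then show ?thesis by (simp add: trunc_loss_def)
  qed
  have width: "E / 2 ^ j \<le> ln (real X + 1) - ln (real X)"
  proof -
    have "2 * log 2 (real X + 1) \<le> real j" unfolding j_def by linarith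
    then have "2 powr (2 * log 2 (real X + 1)) \<le> 2 powr real j" by simp
    moreover have "2 powr (2 * log 2 (real X + 1)) = (real X + 1)\<^sup>2"
      by (simp add: powr_mult[symmetric] powr_powr[symmetric] mult.commute[of 2] powr_realpow[symmetric] flip: powr_numeral)
    ultimately have "(real X + 1)\<^sup>2 \<le> 2 ^ j" by (simp add: powr_realpow)
    moreover have "E \<le> real X" unfolding E_def using ln_add_one_self_le_self[of "real X"] by (simp add: add.commute)
    ultimately have "E / 2 ^ j \<le> real X / (real X + 1)\<^sup>2" using E by (intro frac_le) auto
    also have "\<dots> \<le> (real X + 1) / (real X + 1)\<^sup>2" by (intro divide_right_mono) auto
    also have "\<dots> = 1 / (real X + 1)" by (simp add: power2_eq_square)
    also have "\<dots> \<le> ln (real X + 1) - ln (real X)"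
    proof -
      have "ln (real X / (real X + 1)) \<le> real X / (real X + 1) - 1"
        using X by (intro ln_le_minus_one) simp
      also have "\<dots> = - 1 / (real X + 1)" by (simp add: field_simps)
      finally show ?thesis using X by (simp add: ln_div)
    qed
    finally show ?thesis .
  qed
  have "laurent_bounded (C * (1 + real j / 2))
      (\<lambda>\<gamma>. of_real (min 1 (max 0 ((E - log_val \<gamma>) / (E / 2 ^ j)))) * A \<gamma>)"
  proof (rule laurent_bounded_ramp[OF A log_val_diff E])
    fix \<gamma> assume neg: "log_val \<gamma> < 0"
    show "A \<gamma> = 0"
    proof (rule ccontr)
      assume "A \<gamma> \<noteq> 0"
      then have "\<gamma> \<in> zinf_plus" using supp by blast
      then show False using neg prime_pow_pos[of \<gamma>] by (simp add: log_val_eq_ln_prime_pow)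
    qed
  qed
  moreover have "of_real (min 1 (max 0 ((E - log_val \<gamma>) / (E / 2 ^ j)))) * A \<gamma>
      = (if prime_pow \<gamma> \<le> X then A \<gamma> else 0)" for \<gamma>
  proof (cases "\<gamma> \<in> zinf_plus")
    case True
    have w: "0 < E / 2 ^ j" using E by simp
    have pos: "0 < real (prime_pow \<gamma>)" using prime_pow_pos[of \<gamma>] by simp
    show ?thesis
    proof (cases "prime_pow \<gamma> \<le> X")
      case le: True
      then have "log_val \<gamma> \<le> ln (real X)" using True pos by (simp add: log_val_eq_ln_prime_pow)
      then have "E / 2 ^ j \<le> E - log_val \<gamma>" using width by (simp add: E_def)
      then have "1 \<le> (E - log_val \<gamma>) / (E / 2 ^ j)" using w by (simp only: le_divide_eq_1_pos)
      then show ?thesis using le by simp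
    next
      case False
      then have "E \<le> log_val \<gamma>" unfolding E_def log_val_eq_ln_prime_pow[OF True] by (subst ln_le_cancel_iff) auto
      then have "(E - log_val \<gamma>) / (E / 2 ^ j) \<le> 0" using w by (intro divide_nonpos_pos) auto
      then show ?thesis using False by simp
    qed
  qed (simp add: supp)
  ultimately have "laurent_bounded (C * (1 + real j / 2)) (\<lambda>\<gamma>. if prime_pow \<gamma> \<le> X then A \<gamma> else 0)"
    by (simp only:)
  then show ?thesis
    by (rule laurent_bounded_mono) (use j_le C in \<open>auto intro: mult_left_mono\<close>)
qed

definition tail_bound :: "real \<Rightarrow> nat \<Rightarrow> real" where
  "tail_bound \<sigma> X = exp (- \<sigma> * ln (real X)) * (1 + trunc_loss X)"

lemma tail_bound_tendsto: "0 < \<sigma> \<Longrightarrow> tail_bound \<sigma> \<longlonglongrightarrow> 0"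
  unfolding tail_bound_def trunc_loss_def by real_asymp

lemma tail_bound_antimono:
  assumes "\<sigma> \<le> \<sigma>'" "1 \<le> X" shows "tail_bound \<sigma>' X \<le> tail_bound \<sigma> X"
  unfolding tail_bound_def
  by (rule mult_right_mono) (use assms in \<open>auto simp: trunc_loss_def intro: mult_right_mono add_nonneg_nonneg\<close>)

text \<open>
  To the right of \<open>ln X\<close> the damping factor \<open>exp (- \<sigma> \<lambda>)\<close> equals \<open>exp (- \<sigma> ln X)\<close> times
  \<open>exp (- \<sigma> \<bar>\<lambda> - ln X\<bar>)\<close>, which is a multiplier of norm 1. Removing the part with \<open>n \<le> X\<close> adds the
  loss of one truncation.
\<close>

lemma laurent_bounded_damped_tail:
  fixes A :: "zinf \<Rightarrow> complex"
  assumes A: "laurent_bounded C A" and supp: "\<And>\<gamma>. \<gamma> \<notin> zinf_plus \<Longrightarrow> A \<gamma> = 0" and X: "1 \<le> X"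
    and \<sigma>: "0 < \<sigma>"
  shows "laurent_bounded (C * tail_bound \<sigma> X)
           (\<lambda>\<gamma>. if X < prime_pow \<gamma> then of_real (exp (- \<sigma> * log_val \<gamma>)) * A \<gamma> else 0)"
proof -
  let ?m = "\<lambda>\<gamma>. of_real (exp (- \<sigma> * \<bar>log_val \<gamma> - ln (real X)\<bar>)) * A \<gamma>"
  let ?c = "of_real (exp (- \<sigma> * ln (real X)))"
  have m: "laurent_bounded C ?m" by (rule laurent_bounded_exp[OF A log_val_diff \<sigma>])
  have "laurent_bounded (cmod ?c * (C + C * trunc_loss X))
      (\<lambda>\<gamma>. ?c * (?m \<gamma> - (if prime_pow \<gamma> \<le> X then ?m \<gamma> else 0)))"
    by (intro laurent_bounded_cmult laurent_bounded_diff m laurent_bounded_truncate[OF m _ X]) (simp add: supp)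
  moreover have "cmod ?c * (C + C * trunc_loss X) = C * tail_bound \<sigma> X"
    by (simp add: tail_bound_def algebra_simps)
  moreover have "?c * (?m \<gamma> - (if prime_pow \<gamma> \<le> X then ?m \<gamma> else 0))
      = (if X < prime_pow \<gamma> then of_real (exp (- \<sigma> * log_val \<gamma>)) * A \<gamma> else 0)" for \<gamma>
  proof (cases "\<gamma> \<in> zinf_plus \<and> X < prime_pow \<gamma>")
    case True
    then have "ln (real X) \<le> log_val \<gamma>"
      using X by (simp add: log_val_eq_ln_prime_pow)
    then have "exp (- \<sigma> * ln (real X)) * exp (- \<sigma> * \<bar>log_val \<gamma> - ln (real X)\<bar>) = exp (- \<sigma> * log_val \<gamma>)"
      by (simp add: exp_add[symmetric] algebra_simps)
    then have "?c * ?m \<gamma> = of_real (exp (- \<sigma> * log_val \<gamma>)) * A \<gamma>"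
      by (simp only: mult.assoc[symmetric] of_real_mult[symmetric])
    then show ?thesis using True by simp
  qed (auto simp: supp)
  ultimately show ?thesis by (simp only:)
qed

text \<open>
  On \<open>Re s = \<sigma>\<close> the polynomial is the character sum of the damped coefficients for the character
  \<open>\<gamma> \<mapsto> cis (- Im s * \<lambda> \<gamma>)\<close>.
\<close>

lemma dirichlet_poly_le:
  fixes A :: "zinf \<Rightarrow> complex"
  assumes I: "finite I" "I \<subseteq> {1..}"
    and bd: "laurent_bounded K (\<lambda>\<gamma>. if \<gamma> \<in> zinf_plus \<and> prime_pow \<gamma> \<in> I
               then of_real (exp (- Re s * log_val \<gamma>)) * A \<gamma> else 0)"
  shows "cmod (\<Sum>n\<in>I. coeff_seq A n * of_nat n powr (- s)) \<le> K"
proof -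
  define F where "F = {\<gamma> \<in> zinf_plus. prime_pow \<gamma> \<in> I}"
  have bij: "bij_betw prime_pow F I"
    using I(2) bij_betw_prime_pow unfolding F_def bij_betw_def
    by (auto intro: inj_on_subset)
  have finF: "finite F" using bij_betw_finite[OF bij] I(1) by simp
  let ?B = "\<lambda>\<gamma>. if \<gamma> \<in> zinf_plus \<and> prime_pow \<gamma> \<in> I
               then of_real (exp (- Re s * log_val \<gamma>)) * A \<gamma> else 0"
  have "(\<Sum>n\<in>I. coeff_seq A n * of_nat n powr (- s)) = (\<Sum>\<gamma>\<in>F. coeff_seq A (prime_pow \<gamma>) * of_nat (prime_pow \<gamma>) powr (- s))"
    by (rule sum.reindex_bij_betw[OF bij, symmetric])
  also have "\<dots> = (\<Sum>\<gamma>\<in>F. ?B \<gamma> * cis (- Im s * log_val \<gamma>))"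
  proof (rule sum.cong[OF refl])
    fix \<gamma> assume \<gamma>: "\<gamma> \<in> F"
    then have pl: "\<gamma> \<in> zinf_plus" by (simp add: F_def)
    have "coeff_seq A (prime_pow \<gamma>) = A \<gamma>"
      unfolding coeff_seq_def using the_inv_into_f_f[OF bij_betw_imp_inj_on[OF bij_betw_prime_pow] pl] by simp
    moreover have "of_nat (prime_pow \<gamma>) powr (- s) = of_real (exp (- Re s * log_val \<gamma>)) * cis (- Im s * log_val \<gamma>)"
    proof -
      have "of_nat (prime_pow \<gamma>) powr (- s) = exp (- s * of_real (log_val \<gamma>))"
        using prime_pow_pos[of \<gamma>] by (simp add: powr_def log_val_eq_ln_prime_pow[OF pl] Ln_of_nat)
      then show ?thesis by (simp add: exp_eq_polar)
    qed
    ultimately show "coeff_seq A (prime_pow \<gamma>) * of_nat (prime_pow \<gamma>) powr (- s) = ?B \<gamma> * cis (- Im s * log_val \<gamma>)"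
      using \<gamma> by (simp add: F_def)
  qed
  also have "cmod \<dots> \<le> K"
    by (rule laurent_bounded_sum_character_le[OF bd finF])
      (auto simp: F_def log_val_diff algebra_simps)
  finally show ?thesis .
qed

lemma sum_dirichlet_term:
  "(\<Sum>n<N. dirichlet_term a s n) = (\<Sum>n=1..N. a n * of_nat n powr (- s))"
  unfolding One_nat_def sum.atLeast1_atMost_eq by (simp add: dirichlet_term_def)

text \<open>
  A block \<open>X < n \<le> Y\<close> is a difference of two damped tails, so the partial sums are Cauchy at a rate
  depending on \<open>Re s\<close> only. An initial segment is the whole damped function, of norm at most \<open>C\<close>,
  minus a small tail; this gives the bound \<open>C\<close> for the limit.
\<close>

theorem laurent_bounded_imp_in_D_infinity:
  fixes A :: "zinf \<Rightarrow> complex"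
  assumes A: "laurent_bounded C A" and supp: "\<And>\<gamma>. \<gamma> \<notin> zinf_plus \<Longrightarrow> A \<gamma> = 0"
  shows "in_D_infinity (coeff_seq A)" and "D_infinity_norm (coeff_seq A) \<le> C"
proof -
  let ?a = "coeff_seq A"
  let ?S = "\<lambda>N s. \<Sum>n<N. dirichlet_term ?a s n"
  have C: "0 \<le> C" by (rule laurent_bounded_nonneg[OF A])
  have block: "cmod (?S Y s - ?S X s) \<le> C * (tail_bound (Re s) X + tail_bound (Re s) Y)"
    if "0 < Re s" "1 \<le> X" "X \<le> Y" for s X Y
  proof -
    let ?t = "\<lambda>Z \<gamma>. if Z < prime_pow \<gamma> then of_real (exp (- Re s * log_val \<gamma>)) * A \<gamma> else 0"
    have "laurent_bounded (C * tail_bound (Re s) X + C * tail_bound (Re s) Y) (\<lambda>\<gamma>. ?t X \<gamma> - ?t Y \<gamma>)"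
      using that by (intro laurent_bounded_diff laurent_bounded_damped_tail A supp) auto
    moreover have "(\<lambda>\<gamma>. ?t X \<gamma> - ?t Y \<gamma>)
        = (\<lambda>\<gamma>. if \<gamma> \<in> zinf_plus \<and> prime_pow \<gamma> \<in> {X<..Y} then of_real (exp (- Re s * log_val \<gamma>)) * A \<gamma> else 0)"
      using that by (auto simp: fun_eq_iff supp)
    ultimately have "cmod (\<Sum>n\<in>{X<..Y}. ?a n * of_nat n powr (- s)) \<le> C * tail_bound (Re s) X + C * tail_bound (Re s) Y"
      by (intro dirichlet_poly_le) auto
    moreover have "?S Y s - ?S X s = (\<Sum>n\<in>{X<..Y}. ?a n * of_nat n powr (- s))"
    proof -
      have "{1..Y} = {1..X} \<union> {X<..Y}" using that by auto
      then have "(\<Sum>n=1..Y. ?a n * of_nat n powr (- s))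
          = (\<Sum>n=1..X. ?a n * of_nat n powr (- s)) + (\<Sum>n\<in>{X<..Y}. ?a n * of_nat n powr (- s))"
        by (simp only:) (rule sum.union_disjoint; auto)
      then show ?thesis unfolding sum_dirichlet_term by simp
    qed
    ultimately show ?thesis by (simp add: distrib_left)
  qed
  have head: "cmod (?S X s) \<le> C * (1 + tail_bound (Re s) X)" if "0 < Re s" "1 \<le> X" for s X
  proof -
    let ?t = "\<lambda>\<gamma>. if X < prime_pow \<gamma> then of_real (exp (- Re s * log_val \<gamma>)) * A \<gamma> else 0"
    let ?m = "\<lambda>\<gamma>. of_real (exp (- Re s * \<bar>log_val \<gamma> - 0\<bar>)) * A \<gamma>"
    have "laurent_bounded (C + C * tail_bound (Re s) X) (\<lambda>\<gamma>. ?m \<gamma> - ?t \<gamma>)"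
      using that by (intro laurent_bounded_diff laurent_bounded_damped_tail laurent_bounded_exp A supp log_val_diff) auto
    moreover have "(\<lambda>\<gamma>. ?m \<gamma> - ?t \<gamma>)
        = (\<lambda>\<gamma>. if \<gamma> \<in> zinf_plus \<and> prime_pow \<gamma> \<in> {1..X} then of_real (exp (- Re s * log_val \<gamma>)) * A \<gamma> else 0)"
    proof
      fix \<gamma>
      show "?m \<gamma> - ?t \<gamma> = (if \<gamma> \<in> zinf_plus \<and> prime_pow \<gamma> \<in> {1..X} then of_real (exp (- Re s * log_val \<gamma>)) * A \<gamma> else 0)"
      proof (cases "\<gamma> \<in> zinf_plus")
        case True
        have "0 \<le> log_val \<gamma>" "1 \<le> prime_pow \<gamma>"
          using prime_pow_pos[of \<gamma>] by (simp_all add: log_val_eq_ln_prime_pow[OF True] Suc_le_eq)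
        then show ?thesis using True by auto
      qed (simp add: supp)
    qed
    ultimately have "cmod (\<Sum>n\<in>{1..X}. ?a n * of_nat n powr (- s)) \<le> C + C * tail_bound (Re s) X"
      by (intro dirichlet_poly_le) auto
    then show ?thesis unfolding sum_dirichlet_term by (simp add: distrib_left)
  qed
  have summ: "summable (dirichlet_term ?a s)" if s: "0 < Re s" for s
    unfolding summable_iff_convergent
  proof (rule Cauchy_convergent, rule metric_CauchyI)
    fix e :: real assume e: "0 < e"
    have "(\<lambda>X. C * tail_bound (Re s) X) \<longlonglongrightarrow> C * 0"
      by (intro tendsto_intros tail_bound_tendsto s)
    then have "\<forall>\<^sub>F X in sequentially. C * tail_bound (Re s) X < e / 2"
      by (rule order_tendstoD) (use e in auto)
    then obtain M where M: "\<And>X. M \<le> X \<Longrightarrow> C * tail_bound (Re s) X < e / 2"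
      by (auto simp: eventually_sequentially)
    have lt: "dist (?S X s) (?S Y s) < e" if "max 1 M \<le> X" "X \<le> Y" for X Y
      using block[OF s, of X Y] M[of X] M[of Y] that
      by (simp add: dist_norm norm_minus_commute distrib_left)
    show "\<exists>M. \<forall>m\<ge>M. \<forall>n\<ge>M. dist (?S m s) (?S n s) < e"
    proof (intro exI allI impI)
      fix m n assume "max 1 M \<le> m" "max 1 M \<le> n"
      then show "dist (?S m s) (?S n s) < e"
        using lt[of m n] lt[of n m] by (cases "m \<le> n") (auto simp: dist_commute)
    qed
  qed
  have lim: "(\<lambda>N. ?S N s) \<longlonglongrightarrow> dirichlet_sum ?a s" if "0 < Re s" for s
    using summable_LIMSEQ[OF summ[OF that]] by (simp add: dirichlet_sum_def)
  have rate: "cmod (dirichlet_sum ?a s - ?S X s) \<le> C * tail_bound (Re s) X" if s: "0 < Re s" "1 \<le> X" for s X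
  proof (rule tendsto_le[OF sequentially_bot])
    show "(\<lambda>Y. cmod (?S Y s - ?S X s)) \<longlonglongrightarrow> cmod (dirichlet_sum ?a s - ?S X s)"
      by (intro tendsto_intros lim s)
    have "(\<lambda>Y. C * (tail_bound (Re s) X + tail_bound (Re s) Y)) \<longlonglongrightarrow> C * (tail_bound (Re s) X + 0)"
      by (intro tendsto_intros tail_bound_tendsto s)
    then show "(\<lambda>Y. C * (tail_bound (Re s) X + tail_bound (Re s) Y)) \<longlonglongrightarrow> C * tail_bound (Re s) X" by simp
    show "\<forall>\<^sub>F Y in sequentially. cmod (?S Y s - ?S X s) \<le> C * (tail_bound (Re s) X + tail_bound (Re s) Y)"
      using eventually_ge_at_top[of X] by eventually_elim (use block s in auto)
  qed
  have bound: "cmod (dirichlet_sum ?a s) \<le> C" if s: "0 < Re s" for s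
  proof (rule tendsto_le[OF sequentially_bot])
    show "(\<lambda>N. cmod (?S N s)) \<longlonglongrightarrow> cmod (dirichlet_sum ?a s)" by (intro tendsto_intros lim s)
    have "(\<lambda>N. C * (1 + tail_bound (Re s) N)) \<longlonglongrightarrow> C * (1 + 0)"
      by (intro tendsto_intros tail_bound_tendsto s)
    then show "(\<lambda>N. C * (1 + tail_bound (Re s) N)) \<longlonglongrightarrow> C" by simp
    show "\<forall>\<^sub>F N in sequentially. cmod (?S N s) \<le> C * (1 + tail_bound (Re s) N)"
      using eventually_ge_at_top[of 1] by eventually_elim (use head s in auto)
  qed
  have open_rhp: "open right_half_plane"
    unfolding right_half_plane_def by (rule open_halfspace_Re_gt)
  have hol: "dirichlet_sum ?a holomorphic_on right_half_plane"
  proof (rule holomorphic_uniform_sequence[OF open_rhp])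
    show "?S N holomorphic_on right_half_plane" for N
      unfolding dirichlet_term_def by (intro holomorphic_intros)
    fix z assume "z \<in> right_half_plane"
    then have z: "0 < Re z" by (simp add: right_half_plane_def)
    define r where "r = Re z / 2"
    have r: "0 < r" using z by (simp add: r_def)
    have re: "r \<le> Re w" if "w \<in> cball z r" for w
      using that abs_Re_le_cmod[of "z - w"] by (simp add: r_def dist_norm)
    have "uniform_limit (cball z r) ?S (dirichlet_sum ?a) sequentially"
    proof (rule uniform_limitI)
      fix e :: real assume e: "0 < e"
      have "(\<lambda>X. C * tail_bound r X) \<longlonglongrightarrow> C * 0" by (intro tendsto_intros tail_bound_tendsto r)
      then have "\<forall>\<^sub>F X in sequentially. C * tail_bound r X < e"
        by (rule order_tendstoD) (use e in auto)
      then show "\<forall>\<^sub>F X in sequentially. \<forall>w\<in>cball z r. dist (?S X w) (dirichlet_sum ?a w) < e"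
        using eventually_ge_at_top[of 1]
      proof eventually_elim
        case (elim X)
        show ?case
        proof
          fix w assume w: "w \<in> cball z r"
          have "dist (?S X w) (dirichlet_sum ?a w) \<le> C * tail_bound (Re w) X"
            using rate[of w X] re[OF w] r elim by (simp add: dist_norm norm_minus_commute)
          also have "\<dots> \<le> C * tail_bound r X"
            using C re[OF w] elim by (intro mult_left_mono tail_bound_antimono)
          finally show "dist (?S X w) (dirichlet_sum ?a w) < e" using elim by simp
        qed
      qed
    qed
    moreover have "cball z r \<subseteq> right_half_plane"
      using re r by (force simp: right_half_plane_def)
    ultimately show "\<exists>d>0. cball z d \<subseteq> right_half_plane \<and> uniform_limit (cball z d) ?S (dirichlet_sum ?a) sequentially"
      using r by blast
  qed
  show "in_D_infinity ?a"
    unfolding in_D_infinity_def using summ hol bound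
    by (auto simp: right_half_plane_def bounded_iff)
  show "D_infinity_norm ?a \<le> C"
    unfolding D_infinity_norm_def
  proof (rule cSUP_least)
    have "1 \<in> right_half_plane" by (simp add: right_half_plane_def)
    then show "right_half_plane \<noteq> {}" by blast
  qed (simp add: bound right_half_plane_def)
qed

section \<open>Mean values on vertical lines\<close>

text \<open>
  Continuity is part of the notion so that all the integrals exist.
\<close>

definition has_mean :: "(real \<Rightarrow> complex) \<Rightarrow> complex \<Rightarrow> bool" where
  "has_mean f l \<longleftrightarrow> continuous_on UNIV f \<and>
     ((\<lambda>T. integral {- T..T} f / of_real (2 * T)) \<longlongrightarrow> l) at_top"

lemma has_mean_integrable: "has_mean f l \<Longrightarrow> f integrable_on {a..b}"
  unfolding has_mean_def by (intro integrable_continuous_interval) (auto intro: continuous_on_subset)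

lemma has_mean_cmult:
  assumes "has_mean f l" shows "has_mean (\<lambda>v. c * f v) (c * l)"
proof -
  have "((\<lambda>T. c * (integral {- T..T} f / of_real (2 * T))) \<longlongrightarrow> c * l) at_top"
    using assms unfolding has_mean_def by (intro tendsto_intros) simp
  moreover have "continuous_on UNIV (\<lambda>v. c * f v)"
    using assms unfolding has_mean_def by (intro continuous_intros) simp
  ultimately show ?thesis by (simp add: has_mean_def)
qed

lemma has_mean_sum:
  assumes "finite S" "\<And>i. i \<in> S \<Longrightarrow> has_mean (f i) (l i)"
  shows "has_mean (\<lambda>v. \<Sum>i\<in>S. f i v) (\<Sum>i\<in>S. l i)"
proof -
  have "((\<lambda>T. \<Sum>i\<in>S. integral {- T..T} (f i) / of_real (2 * T)) \<longlongrightarrow> (\<Sum>i\<in>S. l i)) at_top"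
    using assms unfolding has_mean_def by (intro tendsto_sum) simp
  moreover have "integral {- T..T} (\<lambda>v. \<Sum>i\<in>S. f i v) / of_real (2 * T)
      = (\<Sum>i\<in>S. integral {- T..T} (f i) / of_real (2 * T))" for T
    using assms(1) has_mean_integrable[OF assms(2)]
    by (subst Henstock_Kurzweil_Integration.integral_sum) (auto simp: sum_divide_distrib)
  moreover have "continuous_on UNIV (\<lambda>v. \<Sum>i\<in>S. f i v)"
    using assms unfolding has_mean_def by (intro continuous_intros) simp
  ultimately show ?thesis by (simp add: has_mean_def)
qed

lemma has_mean_norm_le:
  assumes f: "has_mean f l" and g: "has_mean (\<lambda>v. of_real (g v)) (of_real b)"
    and le: "\<And>v. cmod (f v) \<le> g v"
  shows "cmod l \<le> b"
proof (rule tendsto_le)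
  show "((\<lambda>T. cmod (integral {- T..T} f / of_real (2 * T))) \<longlongrightarrow> cmod l) at_top"
    using f unfolding has_mean_def by (intro tendsto_intros) simp
  show "((\<lambda>T. Re (integral {- T..T} (\<lambda>v. of_real (g v)) / of_real (2 * T))) \<longlongrightarrow> b) at_top"
    using g tendsto_Re unfolding has_mean_def by fastforce
  show "\<forall>\<^sub>F T in at_top. cmod (integral {- T..T} f / of_real (2 * T))
      \<le> Re (integral {- T..T} (\<lambda>v. of_real (g v)) / of_real (2 * T))"
    using eventually_gt_at_top[of 0]
  proof eventually_elim
    case (elim T)
    have int: "(\<lambda>v. complex_of_real (g v)) integrable_on {- T..T}" by (rule has_mean_integrable[OF g])
    have intg: "g integrable_on {- T..T}"
      using integrable_linear[OF int bounded_linear_Re] by (simp add: o_def)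
    have "cmod (integral {- T..T} f) \<le> integral {- T..T} g"
      by (rule Henstock_Kurzweil_Integration.integral_norm_bound_integral)
        (use has_mean_integrable[OF f] intg le in auto)
    also have "integral {- T..T} g = Re (integral {- T..T} (\<lambda>v. of_real (g v)))"
      using integral_linear[OF int bounded_linear_Re] by (simp add: o_def)
    finally show ?case using elim by (simp add: norm_divide divide_right_mono)
  qed
qed simp

lemma has_mean_cis: "has_mean (\<lambda>v. cis (w * v)) (if w = 0 then 1 else 0)"
proof (cases "w = 0")
  case True
  have "\<forall>\<^sub>F T in at_top. (1::complex) = integral {- T..T} (\<lambda>v. cis (w * v)) / of_real (2 * T)"
    using eventually_gt_at_top[of 0] by eventually_elim (simp add: True scaleR_conv_of_real)
  then have "((\<lambda>T. integral {- T..T} (\<lambda>v. cis (w * v)) / of_real (2 * T)) \<longlongrightarrow> 1) at_top"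
    by (rule Lim_transform_eventually[OF tendsto_const])
  then show ?thesis using True by (simp add: has_mean_def)
next
  case False
  define F where "F = (\<lambda>v. cis (w * v) / (\<i> * of_real w))"
  have deriv: "(F has_vector_derivative cis (w * v)) (at v within A)" for v A
  proof -
    have "((\<lambda>v. exp (\<i> * of_real w * of_real v) / (\<i> * of_real w)) has_vector_derivative exp (\<i> * of_real w * of_real v)) (at v within A)"
      using False by (auto intro!: derivative_eq_intros has_vector_derivative_real_field)
    then show ?thesis by (simp add: F_def cis_conv_exp mult_ac)
  qed
  have int: "integral {- T..T} (\<lambda>v. cis (w * v)) = F T - F (- T)" if "0 < T" for T
    by (rule integral_unique, rule fundamental_theorem_of_calculus) (use that deriv in auto)
  have "((\<lambda>T. 1 / (\<bar>w\<bar> * T)) \<longlongrightarrow> 0) at_top" using False by real_asymp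
  moreover have "\<forall>\<^sub>F T in at_top. cmod (integral {- T..T} (\<lambda>v. cis (w * v)) / of_real (2 * T)) \<le> 1 / (\<bar>w\<bar> * T)"
    using eventually_gt_at_top[of 0]
  proof eventually_elim
    case (elim T)
    have "cmod (F T - F (- T)) \<le> cmod (F T) + cmod (F (- T))" by (rule norm_triangle_ineq4)
    also have "\<dots> = 2 / \<bar>w\<bar>" by (simp add: F_def norm_divide norm_mult)
    finally have "cmod (F T - F (- T)) / (2 * T) \<le> 2 / \<bar>w\<bar> / (2 * T)"
      using elim by (intro divide_right_mono) auto
    then show ?case using elim int[of T] by (simp add: norm_divide)
  qed
  ultimately have "((\<lambda>T. integral {- T..T} (\<lambda>v. cis (w * v)) / of_real (2 * T)) \<longlongrightarrow> 0) at_top"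
    by (rule Lim_null_comparison[rotated])
  moreover have "continuous_on UNIV (\<lambda>v. cis (w * v))" by (intro continuous_intros)
  ultimately show ?thesis using False by (simp add: has_mean_def)
qed

lemma has_mean_norm_square:
  fixes w :: "'b \<Rightarrow> real"
  assumes S: "finite S" and inj: "inj_on w S"
  shows "has_mean (\<lambda>v. of_real ((cmod (\<Sum>i\<in>S. c i * cis (w i * v)))\<^sup>2)) (of_real (\<Sum>i\<in>S. (cmod (c i))\<^sup>2))"
proof -
  have "has_mean (\<lambda>v. \<Sum>i\<in>S. \<Sum>j\<in>S. c i * cnj (c j) * cis ((w i - w j) * v))
      (\<Sum>i\<in>S. \<Sum>j\<in>S. c i * cnj (c j) * (if w i - w j = 0 then 1 else 0))"
    by (intro has_mean_sum has_mean_cmult has_mean_cis S)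
  moreover have "(\<Sum>i\<in>S. \<Sum>j\<in>S. c i * cnj (c j) * (if w i - w j = 0 then 1 else 0))
      = of_real (\<Sum>i\<in>S. (cmod (c i))\<^sup>2)"
  proof -
    have "(\<Sum>j\<in>S. c i * cnj (c j) * (if w i - w j = 0 then 1 else 0)) = of_real ((cmod (c i))\<^sup>2)" if "i \<in> S" for i
    proof -
      have "(\<Sum>j\<in>S. c i * cnj (c j) * (if w i - w j = 0 then 1 else 0))
          = (\<Sum>j\<in>S. if j = i then c i * cnj (c j) else 0)"
        using inj that by (intro sum.cong) (auto dest: inj_onD)
      also have "\<dots> = of_real ((cmod (c i))\<^sup>2)"
        using S that by (simp only: sum.delta complex_norm_square) simp
      finally show ?thesis .
    qed
    then show ?thesis by simp
  qed
  moreover have "(\<Sum>i\<in>S. \<Sum>j\<in>S. c i * cnj (c j) * cis ((w i - w j) * v))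
      = of_real ((cmod (\<Sum>i\<in>S. c i * cis (w i * v)))\<^sup>2)" for v
    unfolding complex_norm_square
    by (simp add: sum_product cis_cnj cis_mult algebra_simps)
  ultimately show ?thesis by (simp only:)
qed

lemma has_mean_uniform_limit:
  assumes f: "\<And>n::nat. has_mean (f n) (l n)" and uni: "uniform_limit UNIV f g sequentially"
    and l: "l \<longlonglongrightarrow> L"
  shows "has_mean g L"
proof -
  have cont: "continuous_on UNIV g"
    by (rule uniform_limit_theorem[OF _ uni]) (use f in \<open>auto simp: has_mean_def\<close>)
  have intg: "g integrable_on {a..b}" for a b
    by (intro integrable_continuous_interval) (use cont in \<open>auto intro: continuous_on_subset\<close>)
  have unimean: "uniform_limit {0<..} (\<lambda>n T. integral {- T..T} (f n) / of_real (2 * T))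
      (\<lambda>T. integral {- T..T} g / of_real (2 * T)) sequentially"
  proof (rule uniform_limitI)
    fix e :: real assume e: "0 < e"
    have "\<forall>\<^sub>F n in sequentially. \<forall>v\<in>UNIV. dist (f n v) (g v) < e / 2"
      using uniform_limitD[OF uni, of "e / 2"] e by simp
    then show "\<forall>\<^sub>F n in sequentially. \<forall>T\<in>{0<..}.
        dist (integral {- T..T} (f n) / of_real (2 * T)) (integral {- T..T} g / of_real (2 * T)) < e"
    proof eventually_elim
      case (elim n)
      show ?case
      proof
        fix T :: real assume T: "T \<in> {0<..}"
        have "cmod (integral {- T..T} (\<lambda>v. f n v - g v)) \<le> integral {- T..T} (\<lambda>_. e / 2)"
          using elim by (intro Henstock_Kurzweil_Integration.integral_norm_bound_integral
              Henstock_Kurzweil_Integration.integrable_diff has_mean_integrable[OF f] intg)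
            (auto simp: dist_norm intro: less_imp_le)
        also have "\<dots> = e * T" using T by simp
        finally have "cmod (integral {- T..T} (f n) - integral {- T..T} g) / (2 * T) \<le> e * T / (2 * T)"
          using T has_mean_integrable[OF f] intg
          by (intro divide_right_mono) (auto simp: Henstock_Kurzweil_Integration.integral_diff)
        also have "\<dots> < e" using T e by simp
        finally show "dist (integral {- T..T} (f n) / of_real (2 * T)) (integral {- T..T} g / of_real (2 * T)) < e"
          using T by (simp add: dist_norm norm_divide flip: diff_divide_distrib)
      qed
    qed
  qed
  have "((\<lambda>T. integral {- T..T} g / of_real (2 * T)) \<longlongrightarrow> L) at_top"
    by (rule swap_uniform_limit'[OF _ l unimean])
      (use f eventually_gt_at_top[of "0::real"] in \<open>auto simp: has_mean_def\<close>)
  with cont show ?thesis by (simp add: has_mean_def)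
qed

text \<open>
  A primitive \<open>F\<close> of \<open>f\<close> exists on the half-plane. The integral of \<open>f\<close> over a vertical segment is a
  difference of two values of \<open>F\<close>, and these change by at most \<open>B \<bar>\<sigma> - \<rho>\<bar>\<close> when the segment is moved
  from abscissa \<open>\<rho>\<close> to \<open>\<sigma>\<close>. Division by the length \<open>2 T\<close> removes the difference in the limit.
\<close>

lemma has_mean_vertical_line_shift:
  assumes hol: "f holomorphic_on {s. 0 < Re s}"
    and bd: "\<And>s. 0 < Re s \<Longrightarrow> Re s \<le> max \<rho> \<sigma> \<Longrightarrow> cmod (f s) \<le> B"
    and pos: "0 < \<rho>" "0 < \<sigma>"
    and mean: "has_mean (\<lambda>v. f (Complex \<rho> v)) l"
  shows "has_mean (\<lambda>v. f (Complex \<sigma> v)) l"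
proof -
  let ?H = "{s. 0 < Re s}" and ?K = "{s. 0 < Re s} \<inter> {s. Re s \<le> max \<rho> \<sigma>}"
  have openH: "open ?H" by (rule open_halfspace_Re_gt)
  have convK: "convex ?K" by (intro convex_Int convex_halfspace_Re_gt convex_halfspace_Re_le)
  obtain F where F': "\<And>s. s \<in> ?H \<Longrightarrow> (F has_field_derivative f s) (at s within ?H)"
    using holomorphic_convex_primitive'[OF convex_halfspace_Re_gt openH hol] by blast
  have F: "(F has_field_derivative f s) (at s within A)" if "0 < Re s" for s A
    using F'[of s] that at_within_open[OF _ openH, of s] by (auto intro: has_field_derivative_at_within)
  have cont: "continuous_on UNIV (\<lambda>v. f (Complex r v))" if "0 < r" for r
  proof (rule continuous_on_compose2[OF holomorphic_on_imp_continuous_on[OF hol]])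
    show "continuous_on UNIV (Complex r)" unfolding Complex_eq by (intro continuous_intros)
  qed (use that in auto)
  have int: "integral {- T..T} (\<lambda>v. f (Complex r v)) = (F (Complex r T) - F (Complex r (- T))) / \<i>"
    if r: "0 < r" and T: "0 < T" for r T
  proof (rule integral_unique)
    have "((\<lambda>v. F (Complex r v)) has_vector_derivative \<i> * f (Complex r v)) (at v within A)" for v A
    proof -
      have "(Complex r has_vector_derivative \<i>) (at v)"
        unfolding Complex_eq by (auto intro!: derivative_eq_intros)
      from field_vector_diff_chain_at[OF this F] show ?thesis
        using r by (auto simp: o_def intro: has_vector_derivative_at_within)
    qed
    then have "((\<lambda>v. \<i> * f (Complex r v)) has_integral F (Complex r T) - F (Complex r (- T))) {- T..T}"
      using T by (intro fundamental_theorem_of_calculus) auto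
    from has_integral_mult_right[OF this, of "1 / \<i>"]
    show "((\<lambda>v. f (Complex r v)) has_integral (F (Complex r T) - F (Complex r (- T))) / \<i>) {- T..T}"
      by simp
  qed
  have shift: "cmod (F (Complex \<sigma> v) - F (Complex \<rho> v)) \<le> B * \<bar>\<sigma> - \<rho>\<bar>" for v
  proof -
    have "cmod (F (Complex \<sigma> v) - F (Complex \<rho> v)) \<le> B * cmod (Complex \<sigma> v - Complex \<rho> v)"
      by (rule field_differentiable_bound[OF convK F]) (use bd pos in auto)
    also have "cmod (Complex \<sigma> v - Complex \<rho> v) = \<bar>\<sigma> - \<rho>\<bar>"
      by (simp add: cmod_def)
    finally show ?thesis .
  qed
  have "((\<lambda>T. B * \<bar>\<sigma> - \<rho>\<bar> / T) \<longlongrightarrow> 0) at_top" by real_asymp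
  moreover have "\<forall>\<^sub>F T in at_top. cmod (integral {- T..T} (\<lambda>v. f (Complex \<sigma> v)) / of_real (2 * T)
      - integral {- T..T} (\<lambda>v. f (Complex \<rho> v)) / of_real (2 * T)) \<le> B * \<bar>\<sigma> - \<rho>\<bar> / T"
    using eventually_gt_at_top[of 0]
  proof eventually_elim
    case (elim T)
    have "integral {- T..T} (\<lambda>v. f (Complex \<sigma> v)) - integral {- T..T} (\<lambda>v. f (Complex \<rho> v))
        = ((F (Complex \<sigma> T) - F (Complex \<rho> T)) - (F (Complex \<sigma> (- T)) - F (Complex \<rho> (- T)))) / \<i>"
      using elim pos by (simp add: int diff_divide_distrib algebra_simps)
    also have "cmod \<dots> \<le> B * \<bar>\<sigma> - \<rho>\<bar> + B * \<bar>\<sigma> - \<rho>\<bar>"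
      using order_trans[OF norm_triangle_ineq4 add_mono[OF shift shift]] by (simp add: norm_divide norm_mult)
    finally have "cmod (integral {- T..T} (\<lambda>v. f (Complex \<sigma> v)) - integral {- T..T} (\<lambda>v. f (Complex \<rho> v))) / (2 * T)
        \<le> (B * \<bar>\<sigma> - \<rho>\<bar> + B * \<bar>\<sigma> - \<rho>\<bar>) / (2 * T)"
      using elim by (intro divide_right_mono) auto
    then show ?case using elim by (simp add: norm_divide flip: diff_divide_distrib)
  qed
  ultimately have "((\<lambda>T. integral {- T..T} (\<lambda>v. f (Complex \<sigma> v)) / of_real (2 * T)
      - integral {- T..T} (\<lambda>v. f (Complex \<rho> v)) / of_real (2 * T)) \<longlongrightarrow> 0) at_top"
    by (rule Lim_null_comparison[rotated])
  from tendsto_add[OF this] mean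
  have "((\<lambda>T. integral {- T..T} (\<lambda>v. f (Complex \<sigma> v)) / of_real (2 * T)) \<longlongrightarrow> l) at_top"
    unfolding has_mean_def by fastforce
  with cont[OF pos(2)] show ?thesis by (simp add: has_mean_def)
qed

section \<open>From bounded Dirichlet series to bounded Laurent matrices\<close>

lemma of_nat_powr_Complex:
  "of_nat (Suc n) powr (- Complex r v) = of_real (exp (- r * ln (real (Suc n)))) * cis (- ln (real (Suc n)) * v)"
proof -
  have "of_nat (Suc n) powr (- Complex r v) = exp (- Complex r v * of_real (ln (real (Suc n))))"
    unfolding powr_def by (subst Ln_of_nat) (auto simp del: of_nat_Suc)
  then show ?thesis by (simp add: exp_eq_polar mult_ac del: of_nat_Suc)
qed

text \<open>
  Convergence at \<open>s = 1\<close> bounds \<open>a n / n\<close>, so on \<open>Re s = 3\<close> the series converges uniformly and the mean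
  can be taken term by term. Only the term with \<open>ln n = \<lambda> \<gamma>\<close> contributes, and there is none if
  \<open>\<gamma>\<close> is outside \<open>\<int>\<^sup>\<infinity>\<^sub>+\<close>.
\<close>

lemma has_mean_dirichlet_sum_far:
  assumes conv: "summable (dirichlet_term a 1)"
  shows "has_mean (\<lambda>v. dirichlet_sum a (Complex 3 v) * exp (of_real (log_val \<gamma>) * Complex 3 v)) (coeff_fun a \<gamma>)"
proof -
  let ?E = "\<lambda>v. exp (of_real (log_val \<gamma>) * Complex 3 v)"
  let ?f = "\<lambda>n v. dirichlet_term a (Complex 3 v) n * ?E v"
  let ?l = "\<lambda>n. if log_val \<gamma> = ln (real (Suc n)) then a (Suc n) else 0"
  have E: "?E v = of_real (exp (3 * log_val \<gamma>)) * cis (log_val \<gamma> * v)" for v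
    by (simp add: exp_eq_polar mult_ac)
  have "dirichlet_term a 1 \<longlonglongrightarrow> 0" by (rule summable_LIMSEQ_zero[OF conv])
  then have "Bseq (dirichlet_term a 1)" by (rule convergent_imp_Bseq[OF convergentI])
  then obtain K where K: "\<And>n. cmod (dirichlet_term a 1 n) \<le> K" by (elim BseqE) blast
  have norm_term: "cmod (dirichlet_term a (Complex 3 v) n) \<le> K * (1 / (real (Suc n))\<^sup>2)" for n v
  proof -
    have "exp (- 3 * ln (real (Suc n))) = 1 / real (Suc n) * (1 / (real (Suc n))\<^sup>2)"
      by (simp add: exp_minus ln_realpow[symmetric] power2_eq_square power3_eq_cube exp_of_nat_mult[of 3, simplified] field_simps del: of_nat_Suc)
    moreover have "cmod (dirichlet_term a 1 n) = cmod (a (Suc n)) * (1 / real (Suc n))"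
      by (simp add: dirichlet_term_def norm_mult powr_minus divide_inverse norm_inverse del: of_nat_Suc)
    ultimately have "cmod (dirichlet_term a (Complex 3 v) n) = cmod (dirichlet_term a 1 n) * (1 / (real (Suc n))\<^sup>2)"
      unfolding dirichlet_term_def of_nat_powr_Complex
      by (simp add: norm_mult norm_divide norm_power del: of_nat_Suc)
    also have "\<dots> \<le> K * (1 / (real (Suc n))\<^sup>2)" by (intro mult_right_mono K) simp
    finally show ?thesis .
  qed
  have summ: "summable (\<lambda>n. K * (1 / (real (Suc n))\<^sup>2) * exp (3 * log_val \<gamma>))"
  proof (intro summable_mult summable_mult2)
    have "summable (\<lambda>n. inverse (real n ^ 2))" by (rule inverse_power_summable) simp
    then show "summable (\<lambda>n. 1 / (real (Suc n))\<^sup>2)"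
      by (subst (asm) summable_Suc_iff[symmetric]) (simp add: divide_inverse)
  qed
  have norm_f: "cmod (?f n v) \<le> K * (1 / (real (Suc n))\<^sup>2) * exp (3 * log_val \<gamma>)" for n v
    using mult_right_mono[OF norm_term, of "exp (3 * log_val \<gamma>)" v n]
    by (simp add: norm_mult mult.commute[of _ 3] del: of_nat_Suc)
  have "uniform_limit UNIV (\<lambda>N v. \<Sum>n<N. ?f n v) (\<lambda>v. suminf (\<lambda>n. ?f n v)) sequentially"
    by (rule Weierstrass_m_test[OF norm_f summ])
  moreover have "suminf (\<lambda>n. ?f n v) = dirichlet_sum a (Complex 3 v) * ?E v" for v
  proof -
    have "summable (\<lambda>n. K * (1 / (real (Suc n))\<^sup>2) * exp (3 * log_val \<gamma>) / exp (3 * log_val \<gamma>))"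
      by (rule summable_divide[OF summ])
    then have "summable (dirichlet_term a (Complex 3 v))"
      by (rule summable_comparison_test[rotated]) (use norm_term in auto)
    then show ?thesis unfolding dirichlet_sum_def by (rule suminf_mult2[symmetric])
  qed
  ultimately have uni: "uniform_limit UNIV (\<lambda>N v. \<Sum>n<N. ?f n v) (\<lambda>v. dirichlet_sum a (Complex 3 v) * ?E v) sequentially"
    by simp
  have term_mean: "has_mean (?f n) (?l n)" for n
  proof -
    let ?w = "log_val \<gamma> - ln (real (Suc n))"
    have eq: "?f n v = a (Suc n) * of_real (exp (3 * ?w)) * cis (?w * v)" for v
      unfolding dirichlet_term_def of_nat_powr_Complex E
      by (simp add: cis_mult exp_add[symmetric] algebra_simps flip: of_real_mult del: of_nat_Suc)
    have "has_mean (\<lambda>v. a (Suc n) * of_real (exp (3 * ?w)) * cis (?w * v))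
        (a (Suc n) * of_real (exp (3 * ?w)) * (if ?w = 0 then 1 else 0))"
      by (intro has_mean_cmult has_mean_cis)
    moreover have "a (Suc n) * of_real (exp (3 * ?w)) * (if ?w = 0 then 1 else 0) = ?l n"
      by simp
    ultimately show ?thesis by (simp only: eq)
  qed
  have "(\<lambda>N. \<Sum>n<N. ?l n) \<longlonglongrightarrow> coeff_fun a \<gamma>"
  proof (rule tendsto_eventually)
    show "\<forall>\<^sub>F N in sequentially. (\<Sum>n<N. ?l n) = coeff_fun a \<gamma>"
      using eventually_ge_at_top[of "prime_pow \<gamma>"]
    proof eventually_elim
      case (elim N)
      have pp: "Suc (prime_pow \<gamma> - 1) = prime_pow \<gamma>" using prime_pow_pos[of \<gamma>] by simp
      have "(\<Sum>n<N. ?l n) = (\<Sum>n<N. if n = prime_pow \<gamma> - 1 then coeff_fun a \<gamma> else 0)"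
      proof (rule sum.cong[OF refl])
        fix n
        show "?l n = (if n = prime_pow \<gamma> - 1 then coeff_fun a \<gamma> else 0)"
          using log_val_eq_ln_iff[of "Suc n" \<gamma>] pp by (auto simp: coeff_fun_def simp del: of_nat_Suc)
      qed
      also have "\<dots> = coeff_fun a \<gamma>" using elim pp by simp
      finally show ?case .
    qed
  qed
  from has_mean_uniform_limit[OF has_mean_sum[OF finite_lessThan term_mean] uni this] show ?thesis .
qed

lemma has_mean_dirichlet_sum:
  assumes a: "in_D_infinity a" and \<sigma>: "0 < \<sigma>"
  shows "has_mean (\<lambda>v. dirichlet_sum a (Complex \<sigma> v) * exp (of_real (log_val \<gamma>) * Complex \<sigma> v)) (coeff_fun a \<gamma>)"
proof -
  obtain B where B: "\<And>s. 0 < Re s \<Longrightarrow> cmod (dirichlet_sum a s) \<le> B"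
    using a unfolding in_D_infinity_def bounded_iff right_half_plane_def by auto
  have B0: "0 \<le> B" using B[of 1] norm_ge_zero[of "dirichlet_sum a 1"] by (simp del: norm_ge_zero)
  show ?thesis
  proof (rule has_mean_vertical_line_shift[where f = "\<lambda>s. dirichlet_sum a s * exp (of_real (log_val \<gamma>) * s)" and \<rho> = 3])
    show "(\<lambda>s. dirichlet_sum a s * exp (of_real (log_val \<gamma>) * s)) holomorphic_on {s. 0 < Re s}"
      using a unfolding in_D_infinity_def right_half_plane_def by (intro holomorphic_intros) auto
    show "cmod (dirichlet_sum a s * exp (of_real (log_val \<gamma>) * s)) \<le> B * exp (\<bar>log_val \<gamma>\<bar> * max 3 \<sigma>)"
      if "0 < Re s" "Re s \<le> max 3 \<sigma>" for s
    proof -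
      have "log_val \<gamma> * Re s \<le> \<bar>log_val \<gamma>\<bar> * max 3 \<sigma>"
        using that by (intro mult_mono) auto
      then show ?thesis using B[OF that(1)] B0 by (auto simp: norm_mult intro!: mult_mono)
    qed
    show "has_mean (\<lambda>v. dirichlet_sum a (Complex 3 v) * exp (of_real (log_val \<gamma>) * Complex 3 v)) (coeff_fun a \<gamma>)"
      using a by (intro has_mean_dirichlet_sum_far) (auto simp: in_D_infinity_def right_half_plane_def)
  qed (use \<sigma> in auto)
qed

text \<open>
  Since \<open>\<lambda>\<close> is a homomorphism, \<open>exp (\<lambda>(\<alpha> - \<beta>) s)\<close> splits into a factor in \<open>\<alpha>\<close> and a factor in \<open>\<beta>\<close>,
  so the form is the mean of \<open>D P R\<close> over \<open>Re s = \<sigma>\<close>, with \<open>P\<close> and \<open>R\<close> built from \<open>x\<close> and \<open>y\<close>.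
  Since \<open>\<lambda>\<close> is injective, the frequencies of \<open>P\<close> are distinct and the mean of \<open>\<bar>P\<bar>\<^sup>2\<close> is the sum of the
  squared coefficients, and likewise for \<open>R\<close>.
\<close>

theorem in_D_infinity_imp_laurent_bounded:
  assumes a: "in_D_infinity a"
  shows "laurent_bounded (D_infinity_norm a) (coeff_fun a)"
proof (rule laurent_boundedI)
  fix S :: "zinf set" and x y :: "zinf \<Rightarrow> complex"
  assume S: "finite S"
  define C where "C = D_infinity_norm a"
  have C: "cmod (dirichlet_sum a s) \<le> C" if "0 < Re s" for s
    unfolding C_def D_infinity_norm_def
  proof (rule cSUP_upper)
    show "bdd_above ((\<lambda>s. cmod (dirichlet_sum a s)) ` right_half_plane)"
      using a unfolding in_D_infinity_def bounded_iff bdd_above_def by auto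
  qed (use that in \<open>simp add: right_half_plane_def\<close>)
  let ?Q = "\<Sum>\<alpha>\<in>S. \<Sum>\<beta>\<in>S. coeff_fun a (\<alpha> - \<beta>) * x \<alpha> * y \<beta>"
  let ?X = "\<lambda>\<sigma> \<alpha>. x \<alpha> * of_real (exp (\<sigma> * log_val \<alpha>))" and ?Y = "\<lambda>\<sigma> \<beta>. y \<beta> * of_real (exp (- \<sigma> * log_val \<beta>))"
  let ?N = "\<lambda>\<sigma>. C * (((\<Sum>\<alpha>\<in>S. (cmod (?X \<sigma> \<alpha>))\<^sup>2) + (\<Sum>\<alpha>\<in>S. (cmod (?Y \<sigma> \<alpha>))\<^sup>2)) / 2)"
  have bound: "cmod ?Q \<le> ?N \<sigma>" if \<sigma>: "0 < \<sigma>" for \<sigma>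
  proof -
    define P where "P = (\<lambda>v. \<Sum>\<alpha>\<in>S. ?X \<sigma> \<alpha> * cis (log_val \<alpha> * v))"
    define R where "R = (\<lambda>v. \<Sum>\<beta>\<in>S. ?Y \<sigma> \<beta> * cis (- log_val \<beta> * v))"
    let ?D = "\<lambda>v. dirichlet_sum a (Complex \<sigma> v)"
    have "has_mean (\<lambda>v. \<Sum>\<alpha>\<in>S. \<Sum>\<beta>\<in>S. x \<alpha> * y \<beta> * (?D v * exp (of_real (log_val (\<alpha> - \<beta>)) * Complex \<sigma> v)))
        (\<Sum>\<alpha>\<in>S. \<Sum>\<beta>\<in>S. x \<alpha> * y \<beta> * coeff_fun a (\<alpha> - \<beta>))"
      by (intro has_mean_sum has_mean_cmult has_mean_dirichlet_sum a \<sigma> S)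
    moreover have "(\<Sum>\<alpha>\<in>S. \<Sum>\<beta>\<in>S. x \<alpha> * y \<beta> * (?D v * exp (of_real (log_val (\<alpha> - \<beta>)) * Complex \<sigma> v)))
        = ?D v * P v * R v" for v
    proof -
      have "exp (of_real (log_val (\<alpha> - \<beta>)) * Complex \<sigma> v)
          = of_real (exp (\<sigma> * log_val \<alpha>)) * cis (log_val \<alpha> * v) * (of_real (exp (- \<sigma> * log_val \<beta>)) * cis (- log_val \<beta> * v))"
        for \<alpha> \<beta>
      proof -
        have "of_real (exp (\<sigma> * log_val \<alpha>)) * cis (log_val \<alpha> * v) * (of_real (exp (- \<sigma> * log_val \<beta>)) * cis (- log_val \<beta> * v))
           = of_real (exp (\<sigma> * log_val \<alpha>) * exp (- \<sigma> * log_val \<beta>)) * (cis (log_val \<alpha> * v) * cis (- log_val \<beta> * v))"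
          by (simp only: of_real_mult mult_ac)
        also have "\<dots> = of_real (exp (\<sigma> * log_val (\<alpha> - \<beta>))) * cis (log_val (\<alpha> - \<beta>) * v)"
          by (simp only: exp_add[symmetric] cis_mult log_val_diff) (simp add: algebra_simps)
        also have "\<dots> = exp (of_real (log_val (\<alpha> - \<beta>)) * Complex \<sigma> v)"
          by (simp add: exp_eq_polar mult_ac)
        finally show ?thesis ..
      qed
      then show ?thesis unfolding P_def R_def mult.assoc sum_product by (simp add: sum_distrib_left mult_ac)
    qed
    ultimately have mean: "has_mean (\<lambda>v. ?D v * P v * R v) ?Q"
      by (simp add: mult_ac)
    (* The two squares are treated as a sum over the booleans, to which the sum rule applies. *)
    have "has_mean (\<lambda>v. of_real C * ((1/2) * (\<Sum>b\<in>{True, False}. of_real ((cmod (if b then P v else R v))\<^sup>2))))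
        (of_real C * ((1/2) * (\<Sum>b\<in>{True, False}. of_real (\<Sum>\<alpha>\<in>S. (cmod (if b then ?X \<sigma> \<alpha> else ?Y \<sigma> \<alpha>))\<^sup>2))))"
    proof (intro has_mean_cmult has_mean_sum)
      fix b
      have "has_mean (\<lambda>v. of_real ((cmod (P v))\<^sup>2)) (of_real (\<Sum>\<alpha>\<in>S. (cmod (?X \<sigma> \<alpha>))\<^sup>2))"
        unfolding P_def using inj_log_val by (intro has_mean_norm_square S) (auto intro: inj_on_subset)
      moreover have "has_mean (\<lambda>v. of_real ((cmod (R v))\<^sup>2)) (of_real (\<Sum>\<alpha>\<in>S. (cmod (?Y \<sigma> \<alpha>))\<^sup>2))"
        unfolding R_def using inj_log_val by (intro has_mean_norm_square S) (auto simp: inj_on_def)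
      ultimately show "has_mean (\<lambda>v. of_real ((cmod (if b then P v else R v))\<^sup>2))
          (of_real (\<Sum>\<alpha>\<in>S. (cmod (if b then ?X \<sigma> \<alpha> else ?Y \<sigma> \<alpha>))\<^sup>2))"
        by (cases b) simp_all
    qed simp
    then have mean2: "has_mean (\<lambda>v. of_real (C * (((cmod (P v))\<^sup>2 + (cmod (R v))\<^sup>2) / 2))) (of_real (?N \<sigma>))"
      by simp
    show ?thesis
    proof (rule has_mean_norm_le[OF mean mean2])
      fix v
      have "cmod (?D v * P v * R v) = cmod (?D v) * (cmod (P v) * cmod (R v))" by (simp add: norm_mult)
      also have "\<dots> \<le> C * (((cmod (P v))\<^sup>2 + (cmod (R v))\<^sup>2) / 2)"
        using C[of "Complex \<sigma> v"] \<sigma> sum_squares_bound[of "cmod (P v)" "cmod (R v)"] order_trans[OF norm_ge_zero C[of 1]]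
        by (intro mult_mono) auto
      finally show "cmod (?D v * P v * R v) \<le> C * (((cmod (P v))\<^sup>2 + (cmod (R v))\<^sup>2) / 2)" .
    qed
  qed
  (* The bound does not involve the series any more, so the abscissa can tend to 0. *)
  have "(?N \<longlongrightarrow> ?N 0) (at_right 0)" by (intro tendsto_intros) auto
  then have "cmod ?Q \<le> ?N 0"
    by (rule tendsto_lowerbound) (use bound in \<open>auto simp: eventually_at_right_less eventually_at_filter\<close>)
  then show "cmod ?Q \<le> D_infinity_norm a * (\<Sum>\<alpha>\<in>S. ((cmod (x \<alpha>))\<^sup>2 + (cmod (y \<alpha>))\<^sup>2) / 2)"
    by (simp add: C_def sum.distrib flip: sum_divide_distrib)
qed

section \<open>Hausdorff operators\<close>

lemma space_zinf_aut_borel: "space zinf_aut_borel = zinf_aut"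
  and openin_imp_zinf_aut_borel: "openin zinf_aut_topology U \<Longrightarrow> U \<in> sets zinf_aut_borel"
proof -
  have sub: "{U. openin zinf_aut_topology U} \<subseteq> Pow zinf_aut"
    using openin_subset by (fastforce simp: zinf_aut_topology_def)
  then show "space zinf_aut_borel = zinf_aut" by (simp add: zinf_aut_borel_def space_measure_of)
  show "openin zinf_aut_topology U \<Longrightarrow> U \<in> sets zinf_aut_borel"
    using sub by (simp add: zinf_aut_borel_def sets_measure_of sigma_sets.Basic)
qed

text \<open>
  Evaluation at \<open>\<alpha>\<close> is continuous into a discrete space, so every function of \<open>\<phi> \<alpha>\<close> is measurable.
\<close>

lemma borel_measurable_zinf_aut_eval:
  fixes A :: "zinf \<Rightarrow> complex"
  shows "(\<lambda>\<phi>. A (\<phi> \<alpha>)) \<in> borel_measurable zinf_aut_borel"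
proof (rule borel_measurableI)
  fix U :: "complex set"
  have "openin (product_topology (\<lambda>_. discrete_topology UNIV) UNIV) {\<phi>. \<phi> \<alpha> \<in> A -` U}"
    using openin_continuous_map_preimage[OF continuous_map_product_projection[of \<alpha> UNIV "\<lambda>_. discrete_topology UNIV"], of "A -` U"]
    by simp
  then have "openin zinf_aut_topology ((\<lambda>\<phi>. A (\<phi> \<alpha>)) -` U \<inter> zinf_aut)"
    unfolding zinf_aut_topology_def openin_subtopology by (intro exI[of _ "{\<phi>. \<phi> \<alpha> \<in> A -` U}"]) auto
  then show "(\<lambda>\<phi>. A (\<phi> \<alpha>)) -` U \<inter> space zinf_aut_borel \<in> sets zinf_aut_borel"
    unfolding space_zinf_aut_borel by (rule openin_imp_zinf_aut_borel)
qed

lemma zinf_aut_diff: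
  assumes "\<phi> \<in> zinf_aut" shows "\<phi> (\<alpha> - \<beta>) = \<phi> \<alpha> - \<phi> \<beta>"
proof -
  have "\<phi> ((\<alpha> - \<beta>) + \<beta>) = \<phi> (\<alpha> - \<beta>) + \<phi> \<beta>" using assms unfolding zinf_aut_def by blast
  then show ?thesis by (simp add: algebra_simps)
qed

lemma integrable_hausdorff:
  assumes \<Phi>: "integrable M \<Phi>" and \<tau>: "\<tau> \<in> measurable M zinf_aut_borel" and A: "laurent_bounded C A"
  shows "integrable M (\<lambda>u. \<Phi> u * A (\<tau> u \<alpha>))"
proof (rule Bochner_Integration.integrable_bound)
  show "integrable M (\<lambda>u. of_real C * \<Phi> u)" using \<Phi> by simp
  have "(\<lambda>u. A (\<tau> u \<alpha>)) \<in> borel_measurable M"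
    using measurable_compose[OF \<tau> borel_measurable_zinf_aut_eval] .
  then show "(\<lambda>u. \<Phi> u * A (\<tau> u \<alpha>)) \<in> borel_measurable M" using \<Phi> by measurable
  show "AE u in M. norm (\<Phi> u * A (\<tau> u \<alpha>)) \<le> norm (of_real C * \<Phi> u)"
    using laurent_bounded_norm_le[OF A] laurent_bounded_nonneg[OF A]
    by (intro AE_I2) (auto simp: norm_mult mult.commute[of C] intro: mult_left_mono)
qed

text \<open>
  The form of the averaged function is the integral of \<open>\<Phi> u\<close> times the form of \<open>A \<circ> \<tau> u\<close>, and the
  latter obeys the bound of \<open>A\<close> for every \<open>u\<close>.
\<close>

lemma laurent_bounded_hausdorff:
  assumes \<Phi>: "integrable M \<Phi>" and \<tau>: "\<tau> \<in> measurable M zinf_aut_borel" and A: "laurent_bounded C A"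
  shows "laurent_bounded ((LINT u|M. cmod (\<Phi> u)) * C) (hausdorff M \<Phi> \<tau> A)"
proof (rule laurent_boundedI)
  fix S :: "zinf set" and x y :: "zinf \<Rightarrow> complex"
  assume S: "finite S"
  let ?N = "\<Sum>\<alpha>\<in>S. ((cmod (x \<alpha>))\<^sup>2 + (cmod (y \<alpha>))\<^sup>2) / 2"
  let ?q = "\<lambda>u. \<Sum>\<alpha>\<in>S. \<Sum>\<beta>\<in>S. A (\<tau> u (\<alpha> - \<beta>)) * x \<alpha> * y \<beta>"
  have int: "integrable M (\<lambda>u. \<Phi> u * A (\<tau> u \<gamma>))" for \<gamma>
    by (rule integrable_hausdorff[OF \<Phi> \<tau> A])
  have form: "(\<Sum>\<alpha>\<in>S. \<Sum>\<beta>\<in>S. hausdorff M \<Phi> \<tau> A (\<alpha> - \<beta>) * x \<alpha> * y \<beta>) = (LINT u|M. \<Phi> u * ?q u)"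
    and intq: "integrable M (\<lambda>u. \<Phi> u * ?q u)"
  proof -
    have "has_bochner_integral M (\<lambda>u. \<Sum>\<alpha>\<in>S. \<Sum>\<beta>\<in>S. (\<Phi> u * A (\<tau> u (\<alpha> - \<beta>))) * (x \<alpha> * y \<beta>))
        (\<Sum>\<alpha>\<in>S. \<Sum>\<beta>\<in>S. hausdorff M \<Phi> \<tau> A (\<alpha> - \<beta>) * (x \<alpha> * y \<beta>))"
      unfolding hausdorff_def
      by (intro has_bochner_integral_sum has_bochner_integral_mult_left has_bochner_integral_integrable int)
    then show "(\<Sum>\<alpha>\<in>S. \<Sum>\<beta>\<in>S. hausdorff M \<Phi> \<tau> A (\<alpha> - \<beta>) * x \<alpha> * y \<beta>) = (LINT u|M. \<Phi> u * ?q u)"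
      "integrable M (\<lambda>u. \<Phi> u * ?q u)"
      by (simp_all add: has_bochner_integral_iff sum_distrib_left mult.assoc)
  qed
  have "cmod (LINT u|M. \<Phi> u * ?q u) \<le> (LINT u|M. cmod (\<Phi> u * ?q u))"
    by (rule integral_norm_bound)
  also have "\<dots> \<le> (LINT u|M. cmod (\<Phi> u) * (C * ?N))"
  proof (rule integral_mono)
    show "integrable M (\<lambda>u. cmod (\<Phi> u * ?q u))" by (rule integrable_norm[OF intq])
    show "integrable M (\<lambda>u. cmod (\<Phi> u) * (C * ?N))" using \<Phi> by (intro integrable_mult_left integrable_norm) simp
    fix u assume u: "u \<in> space M"
    then have aut: "\<tau> u \<in> zinf_aut" using measurable_space[OF \<tau>] by (simp add: space_zinf_aut_borel)
    then have "laurent_bounded C (\<lambda>\<gamma>. A (\<tau> u \<gamma>))"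
      by (intro laurent_bounded_compose_hom[OF A] zinf_aut_diff) (auto simp: zinf_aut_def bij_is_inj)
    then have "cmod (?q u) \<le> C * ?N" using S by (rule laurent_boundedD)
    then show "cmod (\<Phi> u * ?q u) \<le> cmod (\<Phi> u) * (C * ?N)"
      by (simp add: norm_mult mult_left_mono)
  qed
  finally show "cmod (\<Sum>\<alpha>\<in>S. \<Sum>\<beta>\<in>S. hausdorff M \<Phi> \<tau> A (\<alpha> - \<beta>) * x \<alpha> * y \<beta>) \<le> (LINT u|M. cmod (\<Phi> u)) * C * ?N"
    unfolding form by (simp add: mult.assoc)
qed

lemma hausdorff_outside_zinf_plus:
  assumes AE: "AE u in M. \<tau> u ` (- zinf_plus) \<subseteq> - zinf_plus"
    and supp: "\<And>\<gamma>. \<gamma> \<notin> zinf_plus \<Longrightarrow> A \<gamma> = 0" and \<alpha>: "\<alpha> \<notin> zinf_plus"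
  shows "hausdorff M \<Phi> \<tau> A \<alpha> = 0"
  unfolding hausdorff_def
proof (rule integral_eq_zero_AE)
  show "AE u in M. \<Phi> u * A (\<tau> u \<alpha>) = 0"
    using AE by eventually_elim (use \<alpha> supp in auto)
qed

text \<open>
  Together with \<open>D_coeffs_imp_laurent_bounded\<close> this identifies \<open>\<D>\<^sub>\<infinity>\<close> isometrically with the
  functions on \<open>\<int>\<^sup>\<infinity>\<^sub>+\<close> that have a bounded Laurent matrix.
\<close>

lemma laurent_bounded_imp_D_coeffs:
  assumes A: "laurent_bounded C A" and supp: "\<And>\<gamma>. \<gamma> \<notin> zinf_plus \<Longrightarrow> A \<gamma> = 0"
  shows "A \<in> D_coeffs" and "D_coeffs_norm A \<le> C"
proof -
  have "A = coeff_fun (coeff_seq A)"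
    using the_inv_into_f_f[OF bij_betw_imp_inj_on[OF bij_betw_prime_pow]] supp
    by (auto simp: fun_eq_iff coeff_fun_def coeff_seq_def)
  then show "A \<in> D_coeffs"
    unfolding D_coeffs_def using laurent_bounded_imp_in_D_infinity(1)[OF A supp] by blast
  show "D_coeffs_norm A \<le> C"
    unfolding D_coeffs_norm_def by (rule laurent_bounded_imp_in_D_infinity(2)[OF A supp])
qed

lemma D_coeffs_imp_laurent_bounded:
  assumes "A \<in> D_coeffs"
  shows "laurent_bounded (D_coeffs_norm A) A" and "\<gamma> \<notin> zinf_plus \<Longrightarrow> A \<gamma> = 0"
proof -
  obtain a where a: "in_D_infinity a" "A = coeff_fun a" using assms by (auto simp: D_coeffs_def)
  show "laurent_bounded (D_coeffs_norm A) A"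
    using in_D_infinity_imp_laurent_bounded[OF a(1)] by (simp add: a(2) D_coeffs_norm_coeff_fun)
  show "\<gamma> \<notin> zinf_plus \<Longrightarrow> A \<gamma> = 0" by (simp add: a(2) coeff_fun_def)
qed

theorem theorem6:
  fixes M :: "'a measure"
    and \<Phi> :: "'a \<Rightarrow> complex"
    and \<tau> :: "'a \<Rightarrow> zinf \<Rightarrow> zinf"
  assumes "integrable M \<Phi>"
    and "\<tau> \<in> measurable M zinf_aut_borel"
    and "AE u in M. \<tau> u ` (- zinf_plus) \<subseteq> - zinf_plus"
  shows "hausdorff_acts_in_D M \<Phi> \<tau> \<and>
    bounded_linear_on_D (hausdorff M \<Phi> \<tau>) \<and>
    D_op_norm (hausdorff M \<Phi> \<tau>) \<le> (LINT u|M. cmod (\<Phi> u))"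
proof (intro conjI)
  let ?H = "hausdorff M \<Phi> \<tau>" and ?L = "LINT u|M. cmod (\<Phi> u)"
  have int: "integrable M (\<lambda>u. \<Phi> u * A (\<tau> u \<alpha>))" if "A \<in> D_coeffs" for A \<alpha>
    by (rule integrable_hausdorff[OF assms(1,2) D_coeffs_imp_laurent_bounded(1)[OF that]])
  have H: "?H A \<in> D_coeffs" "D_coeffs_norm (?H A) \<le> ?L * D_coeffs_norm A" if "A \<in> D_coeffs" for A
  proof -
    note lb = laurent_bounded_hausdorff[OF assms(1,2) D_coeffs_imp_laurent_bounded(1)[OF that]]
    note supp = hausdorff_outside_zinf_plus[OF assms(3) D_coeffs_imp_laurent_bounded(2)[OF that]]
    show "?H A \<in> D_coeffs" "D_coeffs_norm (?H A) \<le> ?L * D_coeffs_norm A"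
      by (rule laurent_bounded_imp_D_coeffs[OF lb supp]; assumption)+
  qed
  show "hausdorff_acts_in_D M \<Phi> \<tau>"
    unfolding hausdorff_acts_in_D_def using int H(1) by blast
  show "bounded_linear_on_D ?H"
    unfolding bounded_linear_on_D_def
  proof (intro conjI ballI allI exI)
    show "?H ` D_coeffs \<subseteq> D_coeffs" using H(1) by blast
    show "?H (\<lambda>\<alpha>. A \<alpha> + B \<alpha>) = (\<lambda>\<alpha>. ?H A \<alpha> + ?H B \<alpha>)" if "A \<in> D_coeffs" "B \<in> D_coeffs" for A B
      using int[OF that(1)] int[OF that(2)]
      by (simp add: fun_eq_iff hausdorff_def distrib_left Bochner_Integration.integral_add)
    show "?H (\<lambda>\<alpha>. c * A \<alpha>) = (\<lambda>\<alpha>. c * ?H A \<alpha>)" if "A \<in> D_coeffs" for c A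
      by (simp add: fun_eq_iff hausdorff_def mult.left_commute[of _ c])
    show "D_coeffs_norm (?H A) \<le> ?L * D_coeffs_norm A" if "A \<in> D_coeffs" for A
      by (rule H(2)[OF that])
  qed
  have L: "0 \<le> ?L" by (rule Bochner_Integration.integral_nonneg) simp
  have lb0: "laurent_bounded 0 (\<lambda>_::zinf. 0)" by (simp add: laurent_bounded_def)
  have zero: "(\<lambda>_. 0) \<in> {A \<in> D_coeffs. D_coeffs_norm A \<le> 1}"
    using laurent_bounded_imp_D_coeffs[OF lb0] by simp
  show "D_op_norm ?H \<le> ?L"
    unfolding D_op_norm_def
  proof (rule cSUP_least)
    show "{A \<in> D_coeffs. D_coeffs_norm A \<le> 1} \<noteq> {}" using zero by blast
    fix A assume A: "A \<in> {A \<in> D_coeffs. D_coeffs_norm A \<le> 1}"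
    then have "?L * D_coeffs_norm A \<le> ?L * 1" using L by (intro mult_left_mono) auto
    with H(2)[of A] A show "D_coeffs_norm (?H A) \<le> ?L" by simp
  qed
qed

end
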